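(* Let $A$ be a positively graded finite-dimensional unital algebra over an algebraically closed field $K$ with $\Lambda_0\ne\emptyset$, equipped with a homogeneous anti-involution $\star$ of degree $0$ satisfying $(L^\lambda)^{\circledast}\simeq L^\lambda$ for each $\lambda\in\Lambda$, and such that $\operatorname{soc}(P^\lambda)\simeq L^\lambda\langle d_\lambda\rangle$ for all $\lambda\in\Lambda_0$. Assume that either $(A,\star)$ is a $\mathbb{Z}$-graded cellular algebra or $(A\text{-gmod},\circledast)$ is a $\mathbb{Z}$-graded highest weight category with a duality functor. If there is a homogeneous idempotent $e\in A$ of degree zero satisfying $Ae\simeq\bigoplus_{\lambda\in\Lambda_0}P^\lambda$ and $e^\star=e$, and there is a double centralizer property between $A$ and $B^{\mathrm{o}}:=\bigl(\operatorname{End}_A(Ae)\bigr)^{\mathrm{op}}$ on $Ae$ (i.e. the canonical map $A\to\operatorname{End}_{-B^{\mathrm{o}}}(Ae)$ to the endomorphisms of the right $B^{\mathrm{o}}$-module $Ae$ is an isomorphism), then $d_\lambda=d_\mu$ for any $\lambda,\mu\in\Lambda_0$ such that $L^\lambda$ and $L^\mu$ belong to the same block of $A$.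
   Context: Positively graded: $A=\bigoplus_{d\ge 0}A_d$ with $A_dA_k\subset A_{d+k}$. $A\text{-gmod}$ is the category of finite-dimensional $\mathbb{Z}$-graded $A$-modules with degree-0 homomorphisms; $M\langle k\rangle_d:=M_{d-k}$; $M\simeq N$ means degree-0 isomorphism; $\operatorname{Hom}_A$ denotes all $A$-homomorphisms. $\{L^\lambda\mid\lambda\in\Lambda\}$ is a complete set of pairwise non-isomorphic simple $A$-modules, each graded by concentration in degree $0$. The projective cover $P^\lambda$ of $L^\lambda$ is graded so that $P^\lambda\to L^\lambda$ has degree $0$, and $P^\lambda=\bigoplus_{i=0}^{d_\lambda}P^\lambda_i$ with $P^\lambda_{d_\lambda}\neq0$. $\Lambda_0:=\{\lambda\in\Lambda\mid P^\lambda\text{ is injective}\}$. The dual of a graded module $M$ is $M^\circledast=\bigoplus_jM^\circledast_j$, $M^\circledast_j:=\operatorname{Hom}_K(M_{-j},K)$, with $(af)(m)=f(a^\star m)$. Two simple modules belong to the same block if they belong to the same indecomposable two-sided ideal in the block decomposition of $A$ (ungraded). $(A,\star)$ is a $\mathbb{Z}$-graded cellular algebra (Hu-Mathas) if there are a finite poset $(\mathcal{P},\le)$, finite sets $T(\gamma)$ for $\gamma\in\mathcal{P}$, a function $\deg:\bigsqcup_\gamma T(\gamma)\to\mathbb{Z}$ and a $K$-basis $\{c_{st}\mid s,t\in T(\gamma),\gamma\in\mathcal{P}\}$ of $A$ such that: $c_{st}$ is homogeneous of degree $\deg s+\deg t$; for $a\in A$ and $s,t\in T(\gamma)$, $a\,c_{st}\equiv\sum_{u\in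 T(\gamma)}r_{us}(a)c_{ut}$ modulo the span of all $c_{u'v'}$ with $u',v'\in T(\gamma')$, $\gamma'>\gamma$, where $r_{us}(a)\in K$ does not depend on $t$; and $\star$ is the anti-involution with $c_{st}^\star=c_{ts}$. $(A\text{-gmod},\circledast)$ is a $\mathbb{Z}$-graded highest weight category with a duality functor if $\Lambda$ carries a partial order and there are graded modules $\Delta^\lambda$ ($\lambda\in\Lambda$) such that: (i) $\Delta^\lambda$ has unique simple head $L^\lambda$ with $(L^\lambda)^\circledast\cong L^\lambda$, and $\{L^\lambda\langle k\rangle\}$ is a complete set of pairwise non-isomorphic graded simple modules; (ii) $\operatorname{Hom}_A(\Delta^\lambda,M)=0$ for all $\lambda$ implies $M=0$; (iii) for each $\lambda$ there is an indecomposable graded projective module $P^\lambda$ and a degree-0 surjection $P^\lambda\to\Delta^\lambda$ whose kernel has a finite filtration with successive quotients of the form $\Delta^\mu\langle k\rangle$ with $\mu>\lambda$, $k\in\mathbb{Z}$; (iv) $\operatorname{End}_A(\Delta^\lambda)\cong K$; (v) $\operatorname{Hom}_A(\Delta^\lambda,\Delta^\mu)\neq0$ implies $\lambda\le\mu$. *)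

theory Defs
  imports
    "HOL-Computational_Algebra.Polynomial"
    "HOL-Library.Function_Algebras"
    "HOL-Library.FuncSet"
begin

section \<open>Modules over an algebra\<close>

text \<open>
  A left module over the ring \<^typ>\<open>'a\<close> is carried by a subset of an ambient abelian group
  \<^typ>\<open>'m\<close>, from which it inherits its addition. The action is only meaningful on the carrier.
  A field of scalars acts on a module through the algebra, by way of \<open>scale c 1\<close>.
\<close>

record ('a, 'm) amod =
  car :: "'m set"
  act :: "'a \<Rightarrow> 'm \<Rightarrow> 'm"

record ('a, 'm) gmod = "('a, 'm) amod" +
  gcomp :: "int \<Rightarrow> 'm set"

definition amodule :: "('a::ring_1, 'm::ab_group_add, 'z) amod_scheme \<Rightarrow> bool" where
  "amodule M \<longleftrightarrow>
     0 \<in> car M \<and>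
     (\<forall>x\<in>car M. \<forall>y\<in>car M. x + y \<in> car M) \<and>
     (\<forall>a. \<forall>x\<in>car M. act M a x \<in> car M) \<and>
     (\<forall>a. \<forall>x\<in>car M. \<forall>y\<in>car M. act M a (x + y) = act M a x + act M a y) \<and>
     (\<forall>a b. \<forall>x\<in>car M. act M (a + b) x = act M a x + act M b x) \<and>
     (\<forall>a b. \<forall>x\<in>car M. act M (a * b) x = act M a (act M b x)) \<and>
     (\<forall>x\<in>car M. act M 1 x = x)"

definition fin_dim ::
  "('k::field \<Rightarrow> 'a::ring_1 \<Rightarrow> 'a) \<Rightarrow> ('a, 'm::ab_group_add, 'z) amod_scheme \<Rightarrow> bool" where
  "fin_dim scale M \<longleftrightarrow>
     (\<exists>B. finite B \<and> B \<subseteq> car M \<and>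
        (\<forall>x\<in>car M. \<exists>c. x = (\<Sum>b\<in>B. act M (scale (c b) 1) b)))"

definition submodule :: "('a::ring_1, 'm::ab_group_add, 'z) amod_scheme \<Rightarrow> 'm set \<Rightarrow> bool" where
  "submodule M N \<longleftrightarrow> N \<subseteq> car M \<and> 0 \<in> N \<and>
     (\<forall>x\<in>N. \<forall>y\<in>N. x + y \<in> N) \<and> (\<forall>a. \<forall>x\<in>N. act M a x \<in> N)"

definition mhom ::
  "('a::ring_1, 'm::ab_group_add, 'y) amod_scheme \<Rightarrow> ('a, 'n::ab_group_add, 'z) amod_scheme
    \<Rightarrow> ('m \<Rightarrow> 'n) set" where
  "mhom M N = {f. f \<in> car M \<rightarrow> car N \<and>
     (\<forall>x\<in>car M. \<forall>y\<in>car M. f (x + y) = f x + f y) \<and>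
     (\<forall>a. \<forall>x\<in>car M. f (act M a x) = act N a (f x))}"

definition mker :: "('a, 'm, 'y) amod_scheme \<Rightarrow> ('m \<Rightarrow> 'n::zero) \<Rightarrow> 'm set" where
  "mker M f = {x \<in> car M. f x = 0}"

definition mod_iso ::
  "('a::ring_1, 'm::ab_group_add, 'y) amod_scheme \<Rightarrow> ('a, 'n::ab_group_add, 'z) amod_scheme \<Rightarrow> bool" where
  "mod_iso M N \<longleftrightarrow> (\<exists>f\<in>mhom M N. bij_betw f (car M) (car N))"

definition simple_module :: "('a::ring_1, 'm::ab_group_add, 'z) amod_scheme \<Rightarrow> bool" where
  "simple_module M \<longleftrightarrow> amodule M \<and> car M \<noteq> {0} \<and>
     (\<forall>N. submodule M N \<longrightarrow> N = {0} \<or> N = car M)"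

definition simple_submodule :: "('a::ring_1, 'm::ab_group_add, 'z) amod_scheme \<Rightarrow> 'm set \<Rightarrow> bool" where
  "simple_submodule M S \<longleftrightarrow> submodule M S \<and> simple_module (M\<lparr>car := S\<rparr>)"

text \<open>The sum of all simple submodules, as the least submodule containing each of them.\<close>

definition soc :: "('a::ring_1, 'm::ab_group_add, 'z) amod_scheme \<Rightarrow> 'm set" where
  "soc M = \<Inter>{N. submodule M N \<and> (\<forall>S. simple_submodule M S \<longrightarrow> S \<subseteq> N)}"

definition maximal_submodule :: "('a::ring_1, 'm::ab_group_add, 'z) amod_scheme \<Rightarrow> 'm set \<Rightarrow> bool" where
  "maximal_submodule M N \<longleftrightarrow> submodule M N \<and> N \<noteq> car M \<and>
     (\<forall>N'. submodule M N' \<longrightarrow> N \<subseteq> N' \<longrightarrow> N' = N \<or> N' = car M)"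

definition rad :: "('a::ring_1, 'm::ab_group_add, 'z) amod_scheme \<Rightarrow> 'm set" where
  "rad M = {x \<in> car M. \<forall>N. maximal_submodule M N \<longrightarrow> x \<in> N}"

text \<open>
  Quantification over all finite-dimensional modules is quantification over those carried by a
  subset of \<^typ>\<open>nat \<Rightarrow> 'k\<close>. This is no restriction: the lemmas \<open>fin_dim_module_universe\<close> and
  \<open>gmodule_universe\<close> below show that each finite-dimensional (graded) module on any type is
  isomorphic to one of these.
\<close>

definition injective_module ::
  "('k::field \<Rightarrow> 'a::ring_1 \<Rightarrow> 'a) \<Rightarrow> ('a, 'm::ab_group_add, 'z) amod_scheme \<Rightarrow> bool" where
  "injective_module scale I \<longleftrightarrow>
     (\<forall>(M :: ('a, nat \<Rightarrow> 'k) amod) (N :: ('a, nat \<Rightarrow> 'k) amod). \<forall>i f.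
        amodule M \<and> fin_dim scale M \<and> amodule N \<and> fin_dim scale N \<and>
        i \<in> mhom M N \<and> inj_on i (car M) \<and> f \<in> mhom M I \<longrightarrow>
        (\<exists>g\<in>mhom N I. \<forall>x\<in>car M. g (i x) = f x))"

definition projective_module ::
  "('k::field \<Rightarrow> 'a::ring_1 \<Rightarrow> 'a) \<Rightarrow> ('a, 'm::ab_group_add, 'z) amod_scheme \<Rightarrow> bool" where
  "projective_module scale Q \<longleftrightarrow>
     (\<forall>(M :: ('a, nat \<Rightarrow> 'k) amod) (N :: ('a, nat \<Rightarrow> 'k) amod). \<forall>p f.
        amodule M \<and> fin_dim scale M \<and> amodule N \<and> fin_dim scale N \<and>
        p \<in> mhom M N \<and> p ` car M = car N \<and> f \<in> mhom Q N \<longrightarrow>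
        (\<exists>g\<in>mhom Q M. \<forall>x\<in>car Q. p (g x) = f x))"

text \<open>Projective covers: a surjection from a projective module with superfluous kernel.\<close>

definition projective_cover ::
  "('k::field \<Rightarrow> 'a::ring_1 \<Rightarrow> 'a) \<Rightarrow> ('a, 'm::ab_group_add, 'y) amod_scheme
    \<Rightarrow> ('a, 'n::ab_group_add, 'z) amod_scheme \<Rightarrow> ('m \<Rightarrow> 'n) \<Rightarrow> bool" where
  "projective_cover scale Q M p \<longleftrightarrow>
     amodule Q \<and> projective_module scale Q \<and> p \<in> mhom Q M \<and> p ` car Q = car M \<and>
     (\<forall>N. submodule Q N \<and> {x + y | x y. x \<in> N \<and> y \<in> mker Q p} = car Q \<longrightarrow> N = car Q)"


section \<open>Graded algebras and graded modules\<close>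

text \<open>The canonical map from the direct sum of the \<open>C i\<close> to \<open>V\<close> is bijective.\<close>

definition internal_direct_sum :: "'m::ab_group_add set \<Rightarrow> 'i set \<Rightarrow> ('i \<Rightarrow> 'm set) \<Rightarrow> bool" where
  "internal_direct_sum V I C \<longleftrightarrow>
     bij_betw (\<lambda>f. \<Sum>i | f i \<noteq> 0. f i)
       {f. (\<forall>i\<in>I. f i \<in> C i) \<and> (\<forall>i. i \<notin> I \<longrightarrow> f i = 0) \<and> finite {i. f i \<noteq> 0}} V"

locale fd_algebra = vector_space scale
  for scale :: "'k::field \<Rightarrow> 'a::ring_1 \<Rightarrow> 'a" +
  assumes scale_mult_left: "scale c x * y = scale c (x * y)"
    and mult_scale_right: "x * scale c y = scale c (x * y)"
    and finite_dimensional: "\<exists>B. finite B \<and> span B = UNIV"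

locale positively_graded_algebra = fd_algebra scale
  for scale :: "'k::field \<Rightarrow> 'a::ring_1 \<Rightarrow> 'a" +
  fixes gr :: "int \<Rightarrow> 'a set"
  assumes gr_subspace: "subspace (gr i)"
    and gr_direct_sum: "internal_direct_sum UNIV UNIV gr"
    and gr_mult: "x \<in> gr i \<Longrightarrow> y \<in> gr j \<Longrightarrow> x * y \<in> gr (i + j)"
    and gr_negative: "i < 0 \<Longrightarrow> gr i = {0}"

text \<open>The objects of the category of finite-dimensional graded modules.\<close>

definition gmodule ::
  "('k::field \<Rightarrow> 'a::ring_1 \<Rightarrow> 'a) \<Rightarrow> (int \<Rightarrow> 'a set) \<Rightarrow> ('a, 'm::ab_group_add) gmod \<Rightarrow> bool" where
  "gmodule scale gr M \<longleftrightarrow>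
     amodule M \<and> fin_dim scale M \<and>
     internal_direct_sum (car M) UNIV (gcomp M) \<and>
     (\<forall>j. 0 \<in> gcomp M j \<and> (\<forall>x\<in>gcomp M j. \<forall>y\<in>gcomp M j. x + y \<in> gcomp M j) \<and>
        (\<forall>c. \<forall>x\<in>gcomp M j. act M (scale c 1) x \<in> gcomp M j)) \<and>
     (\<forall>i j. \<forall>a\<in>gr i. \<forall>x\<in>gcomp M j. act M a x \<in> gcomp M (i + j))"

definition ghom ::
  "('a::ring_1, 'm::ab_group_add) gmod \<Rightarrow> ('a, 'n::ab_group_add) gmod \<Rightarrow> ('m \<Rightarrow> 'n) set" where
  "ghom M N = {f \<in> mhom M N. \<forall>j. f ` gcomp M j \<subseteq> gcomp N j}"

definition gmod_iso ::
  "('a::ring_1, 'm::ab_group_add) gmod \<Rightarrow> ('a, 'n::ab_group_add) gmod \<Rightarrow> bool" where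
  "gmod_iso M N \<longleftrightarrow> (\<exists>f\<in>mhom M N. bij_betw f (car M) (car N) \<and> (\<forall>j. f ` gcomp M j = gcomp N j))"

definition shift :: "('a, 'm) gmod \<Rightarrow> int \<Rightarrow> ('a, 'm) gmod" where
  "shift M k = M\<lparr>gcomp := (\<lambda>j. gcomp M (j - k))\<rparr>"

definition restr :: "('a, 'm) gmod \<Rightarrow> 'm set \<Rightarrow> ('a, 'm) gmod" where
  "restr M N = M\<lparr>car := N, gcomp := (\<lambda>j. gcomp M j \<inter> N)\<rparr>"

definition gsubmodule :: "('a::ring_1, 'm::ab_group_add) gmod \<Rightarrow> 'm set \<Rightarrow> bool" where
  "gsubmodule M N \<longleftrightarrow> submodule M N \<and> internal_direct_sum N UNIV (gcomp (restr M N))"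

definition concentrated_in_degree_0 :: "('a, 'm::zero) gmod \<Rightarrow> bool" where
  "concentrated_in_degree_0 M \<longleftrightarrow> gcomp M 0 = car M \<and> (\<forall>j. j \<noteq> 0 \<longrightarrow> gcomp M j = {0})"

definition gr_simple ::
  "('k::field \<Rightarrow> 'a::ring_1 \<Rightarrow> 'a) \<Rightarrow> (int \<Rightarrow> 'a set) \<Rightarrow> ('a, 'm::ab_group_add) gmod \<Rightarrow> bool" where
  "gr_simple scale gr M \<longleftrightarrow> gmodule scale gr M \<and> car M \<noteq> {0} \<and>
     (\<forall>N. gsubmodule M N \<longrightarrow> N = {0} \<or> N = car M)"

definition gr_projective ::
  "('k::field \<Rightarrow> 'a::ring_1 \<Rightarrow> 'a) \<Rightarrow> (int \<Rightarrow> 'a set) \<Rightarrow> ('a, 'm::ab_group_add) gmod \<Rightarrow> bool" where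
  "gr_projective scale gr Q \<longleftrightarrow> gmodule scale gr Q \<and>
     (\<forall>(M :: ('a, nat \<Rightarrow> 'k) gmod) (N :: ('a, nat \<Rightarrow> 'k) gmod). \<forall>p f.
        gmodule scale gr M \<and> gmodule scale gr N \<and>
        p \<in> ghom M N \<and> p ` car M = car N \<and> f \<in> ghom Q N \<longrightarrow>
        (\<exists>g\<in>ghom Q M. \<forall>x\<in>car Q. p (g x) = f x))"

definition gr_indecomposable :: "('a::ring_1, 'm::ab_group_add) gmod \<Rightarrow> bool" where
  "gr_indecomposable M \<longleftrightarrow> car M \<noteq> {0} \<and>
     (\<forall>N N'. gsubmodule M N \<and> gsubmodule M N' \<and> N \<inter> N' = {0} \<and>
        {x + y | x y. x \<in> N \<and> y \<in> N'} = car M \<longrightarrow> N = {0} \<or> N' = {0})"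

definition direct_sum ::
  "'l set \<Rightarrow> ('l \<Rightarrow> ('a, 'm::ab_group_add) gmod) \<Rightarrow> ('a, 'l \<Rightarrow> 'm) gmod" where
  "direct_sum I M =
     (let F = (\<lambda>C. {x. (\<forall>i\<in>I. x i \<in> C (M i)) \<and> (\<forall>i. i \<notin> I \<longrightarrow> x i = 0) \<and> finite {i. x i \<noteq> 0}})
      in \<lparr>car = F car,
          act = (\<lambda>a x i. if i \<in> I then act (M i) a (x i) else 0),
          gcomp = (\<lambda>j. F (\<lambda>N. gcomp N j))\<rparr>)"

text \<open>
  Linear forms are extended by \<open>0\<close> outside the carrier. A form on the component of degree \<open>- j\<close> is
  identified with its extension by \<open>0\<close> to the other components.
\<close>

definition dual ::
  "('k::field \<Rightarrow> 'a::ring_1 \<Rightarrow> 'a) \<Rightarrow> ('a \<Rightarrow> 'a) \<Rightarrow> ('a, 'm::ab_group_add) gmod \<Rightarrow> ('a, 'm \<Rightarrow> 'k) gmod" where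
  "dual scale star M =
     (let D = {f. (\<forall>x. x \<notin> car M \<longrightarrow> f x = 0) \<and>
                  (\<forall>x\<in>car M. \<forall>y\<in>car M. f (x + y) = f x + f y) \<and>
                  (\<forall>c. \<forall>x\<in>car M. f (act M (scale c 1) x) = c * f x)}
      in \<lparr>car = D,
          act = (\<lambda>a f x. if x \<in> car M then f (act M (star a) x) else 0),
          gcomp = (\<lambda>j. {f \<in> D. \<forall>i. i \<noteq> - j \<longrightarrow> (\<forall>x\<in>gcomp M i. f x = 0)})\<rparr>)"

definition graded_anti_involution ::
  "('k::field \<Rightarrow> 'a::ring_1 \<Rightarrow> 'a) \<Rightarrow> (int \<Rightarrow> 'a set) \<Rightarrow> ('a \<Rightarrow> 'a) \<Rightarrow> bool" where
  "graded_anti_involution scale gr star \<longleftrightarrow>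
     Vector_Spaces.linear scale scale star \<and>
     (\<forall>a b. star (a * b) = star b * star a) \<and>
     (\<forall>a. star (star a) = a) \<and>
     (\<forall>j. star ` gr j \<subseteq> gr j)"


section \<open>Simple modules, projective covers and blocks\<close>

definition complete_simples ::
  "('k::field \<Rightarrow> 'a::ring_1 \<Rightarrow> 'a) \<Rightarrow> 'l set \<Rightarrow> ('l \<Rightarrow> ('a, 'm::ab_group_add) gmod) \<Rightarrow> bool" where
  "complete_simples scale \<Lambda> L \<longleftrightarrow>
     (\<forall>\<mu>\<in>\<Lambda>. simple_module (L \<mu>)) \<and>
     (\<forall>\<mu>\<in>\<Lambda>. \<forall>\<nu>\<in>\<Lambda>. mod_iso (L \<mu>) (L \<nu>) \<longrightarrow> \<mu> = \<nu>) \<and>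
     (\<forall>S :: ('a, nat \<Rightarrow> 'k) amod. simple_module S \<and> fin_dim scale S \<longrightarrow> (\<exists>\<mu>\<in>\<Lambda>. mod_iso S (L \<mu>)))"

definition injective_index ::
  "('k::field \<Rightarrow> 'a::ring_1 \<Rightarrow> 'a) \<Rightarrow> 'l set \<Rightarrow> ('l \<Rightarrow> ('a, 'p::ab_group_add) gmod) \<Rightarrow> 'l set" where
  "injective_index scale \<Lambda> P = {\<mu> \<in> \<Lambda>. injective_module scale (P \<mu>)}"

definition two_sided_ideal :: "'a::ring_1 set \<Rightarrow> bool" where
  "two_sided_ideal I \<longleftrightarrow> 0 \<in> I \<and> (\<forall>x\<in>I. \<forall>y\<in>I. x + y \<in> I) \<and>
     (\<forall>a. \<forall>x\<in>I. a * x \<in> I \<and> x * a \<in> I)"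

definition indecomposable_ideal :: "'a::ring_1 set \<Rightarrow> bool" where
  "indecomposable_ideal I \<longleftrightarrow> two_sided_ideal I \<and> I \<noteq> {0} \<and>
     (\<forall>J J'. two_sided_ideal J \<and> two_sided_ideal J' \<and> J \<inter> J' = {0} \<and>
        {x + y | x y. x \<in> J \<and> y \<in> J'} = I \<longrightarrow> J = {0} \<or> J' = {0})"

definition block_decomposition :: "'a::ring_1 set set \<Rightarrow> bool" where
  "block_decomposition \<B> \<longleftrightarrow> finite \<B> \<and> (\<forall>I\<in>\<B>. indecomposable_ideal I) \<and>
     internal_direct_sum UNIV \<B> (\<lambda>I. I)"

text \<open>A module belongs to a block when the identity element of the block acts as the identity.\<close>

definition belongs_to_block :: "('a::ring_1, 'm::ab_group_add, 'z) amod_scheme \<Rightarrow> 'a set \<Rightarrow> bool" where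
  "belongs_to_block M I \<longleftrightarrow>
     (\<exists>u\<in>I. (\<forall>x\<in>I. u * x = x \<and> x * u = x) \<and> (\<forall>m\<in>car M. act M u m = m))"

definition same_block ::
  "('a::ring_1, 'm::ab_group_add, 'y) amod_scheme \<Rightarrow> ('a, 'n::ab_group_add, 'z) amod_scheme \<Rightarrow> bool" where
  "same_block M N \<longleftrightarrow>
     (\<exists>\<B>. block_decomposition \<B> \<and> (\<exists>I\<in>\<B>. belongs_to_block M I \<and> belongs_to_block N I))"


section \<open>Endomorphism rings and the double centralizer property\<close>

definition endos :: "('a::ring_1, 'm::ab_group_add, 'z) amod_scheme \<Rightarrow> ('m \<Rightarrow> 'm) set" where
  "endos M = mhom M M \<inter> extensional (car M)"

definition left_ideal :: "(int \<Rightarrow> 'a set) \<Rightarrow> 'a::ring_1 \<Rightarrow> ('a, 'a) gmod" where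
  "left_ideal gr e =
     \<lparr>car = {a * e | a. True}, act = (*), gcomp = (\<lambda>j. gr j \<inter> {a * e | a. True})\<rparr>"

text \<open>
  With \<open>B = endos M\<close>, the module \<open>M\<close> is a right module over the opposite ring of \<open>B\<close> by
  \<open>x \<cdot> \<phi> = \<phi> x\<close>, so an endomorphism of this right module is an additive map with
  \<open>g (x \<cdot> \<phi>) = g x \<cdot> \<phi>\<close>. Scalars act by elements of \<open>B\<close>, so linearity over the field is implied.
\<close>

definition right_endos :: "('a::ring_1, 'm::ab_group_add, 'z) amod_scheme \<Rightarrow> ('m \<Rightarrow> 'm) set" where
  "right_endos M = {g \<in> car M \<rightarrow>\<^sub>E car M.
     (\<forall>x\<in>car M. \<forall>y\<in>car M. g (x + y) = g x + g y) \<and>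
     (\<forall>\<phi>\<in>endos M. \<forall>x\<in>car M. g (\<phi> x) = \<phi> (g x))}"

text \<open>The canonical map is a ring homomorphism, so it is an isomorphism iff it is bijective.\<close>

definition double_centralizer :: "('a::ring_1, 'm::ab_group_add, 'z) amod_scheme \<Rightarrow> bool" where
  "double_centralizer M \<longleftrightarrow> bij_betw (\<lambda>a. restrict (act M a) (car M)) UNIV (right_endos M)"


section \<open>Graded cellular algebras\<close>

text \<open>
  The poset and the sets \<open>T \<gamma>\<close> are finite, so they can be taken to consist of natural numbers.
  The sets \<open>T \<gamma>\<close> need not be disjoint, hence \<open>deg\<close> and \<open>c\<close> take \<open>\<gamma>\<close> as an argument.
\<close>

definition graded_cellular ::
  "('k::field \<Rightarrow> 'a::ring_1 \<Rightarrow> 'a) \<Rightarrow> (int \<Rightarrow> 'a set) \<Rightarrow> ('a \<Rightarrow> 'a) \<Rightarrow> bool" where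
  "graded_cellular scale gr star \<longleftrightarrow>
     (\<exists>(\<P> :: nat set) (r :: (nat \<times> nat) set) (T :: nat \<Rightarrow> nat set)
        (deg :: nat \<Rightarrow> nat \<Rightarrow> int) (c :: nat \<Rightarrow> nat \<Rightarrow> nat \<Rightarrow> 'a).
        let I = {(\<gamma>, s, t). \<gamma> \<in> \<P> \<and> s \<in> T \<gamma> \<and> t \<in> T \<gamma>};
            C = (\<lambda>(\<gamma>, s, t). c \<gamma> s t)
        in finite \<P> \<and> partial_order_on \<P> r \<and> (\<forall>\<gamma>\<in>\<P>. finite (T \<gamma>)) \<and>
           inj_on C I \<and> \<not> module.dependent scale (C ` I) \<and> module.span scale (C ` I) = UNIV \<and>
           (\<forall>(\<gamma>, s, t)\<in>I. c \<gamma> s t \<in> gr (deg \<gamma> s + deg \<gamma> t)) \<and>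
           (\<forall>a. \<forall>\<gamma>\<in>\<P>. \<forall>s\<in>T \<gamma>. \<exists>\<rho> :: nat \<Rightarrow> 'k. \<forall>t\<in>T \<gamma>.
              a * c \<gamma> s t - (\<Sum>u\<in>T \<gamma>. scale (\<rho> u) (c \<gamma> u t))
                \<in> module.span scale {c \<gamma>' u v | \<gamma>' u v. (\<gamma>', u, v) \<in> I \<and> (\<gamma>, \<gamma>') \<in> r \<and> \<gamma> \<noteq> \<gamma>'}) \<and>
           (\<forall>(\<gamma>, s, t)\<in>I. star (c \<gamma> s t) = c \<gamma> t s))"


section \<open>Graded highest weight categories with duality\<close>

definition standard_filtration ::
  "('l \<times> 'l) set \<Rightarrow> 'l set \<Rightarrow> ('l \<Rightarrow> ('a::ring_1, 'm::ab_group_add) gmod)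
    \<Rightarrow> 'l \<Rightarrow> ('a, 'n::ab_group_add) gmod \<Rightarrow> 'n set \<Rightarrow> bool" where
  "standard_filtration r \<Lambda> \<Delta> \<mu> Q N \<longleftrightarrow>
     (\<exists>n F. F 0 = {0} \<and> F n = N \<and> (\<forall>i\<le>n. gsubmodule Q (F i)) \<and>
        (\<forall>i<n. F i \<subseteq> F (Suc i) \<and>
          (\<exists>\<nu>\<in>\<Lambda>. \<exists>k. (\<mu>, \<nu>) \<in> r \<and> \<mu> \<noteq> \<nu> \<and>
            (\<exists>f\<in>ghom (restr Q (F (Suc i))) (shift (\<Delta> \<nu>) k).
               f ` F (Suc i) = car (\<Delta> \<nu>) \<and> mker (restr Q (F (Suc i))) f = F i))))"

text \<open>
  Quotients are expressed through surjections with prescribed kernel. A \<open>K\<close>-algebra isomorphism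
  between the field and an endomorphism algebra can only be the canonical map, which sends a
  scalar to its action.
\<close>

definition graded_highest_weight ::
  "('k::field \<Rightarrow> 'a::ring_1 \<Rightarrow> 'a) \<Rightarrow> (int \<Rightarrow> 'a set) \<Rightarrow> ('a \<Rightarrow> 'a)
    \<Rightarrow> 'l set \<Rightarrow> ('l \<Rightarrow> ('a, 'm::ab_group_add) gmod) \<Rightarrow> bool" where
  "graded_highest_weight scale gr star \<Lambda> L \<longleftrightarrow>
     (\<exists>(r :: ('l \<times> 'l) set) (\<Delta> :: 'l \<Rightarrow> ('a, nat \<Rightarrow> 'k) gmod).
        partial_order_on \<Lambda> r \<and> (\<forall>\<mu>\<in>\<Lambda>. gmodule scale gr (\<Delta> \<mu>)) \<and>
        (\<forall>\<mu>\<in>\<Lambda>. \<exists>p\<in>ghom (\<Delta> \<mu>) (L \<mu>). p ` car (\<Delta> \<mu>) = car (L \<mu>) \<and> mker (\<Delta> \<mu>) p = rad (\<Delta> \<mu>)) \<and>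
        (\<forall>\<mu>\<in>\<Lambda>. gmod_iso (dual scale star (L \<mu>)) (L \<mu>)) \<and>
        (\<forall>\<mu>\<in>\<Lambda>. \<forall>k. gr_simple scale gr (shift (L \<mu>) k)) \<and>
        (\<forall>\<mu>\<in>\<Lambda>. \<forall>\<nu>\<in>\<Lambda>. \<forall>j k. gmod_iso (shift (L \<mu>) j) (shift (L \<nu>) k) \<longrightarrow> \<mu> = \<nu> \<and> j = k) \<and>
        (\<forall>S :: ('a, nat \<Rightarrow> 'k) gmod. gr_simple scale gr S \<longrightarrow>
           (\<exists>\<mu>\<in>\<Lambda>. \<exists>k. gmod_iso S (shift (L \<mu>) k))) \<and>
        (\<forall>M :: ('a, nat \<Rightarrow> 'k) gmod. gmodule scale gr M \<longrightarrow>
           (\<forall>\<mu>\<in>\<Lambda>. \<forall>f\<in>mhom (\<Delta> \<mu>) M. \<forall>x\<in>car (\<Delta> \<mu>). f x = 0) \<longrightarrow> car M = {0}) \<and>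
        (\<forall>\<mu>\<in>\<Lambda>. \<exists>(Q :: ('a, nat \<Rightarrow> 'k) gmod) p.
           gr_projective scale gr Q \<and> gr_indecomposable Q \<and>
           p \<in> ghom Q (\<Delta> \<mu>) \<and> p ` car Q = car (\<Delta> \<mu>) \<and>
           standard_filtration r \<Lambda> \<Delta> \<mu> Q (mker Q p)) \<and>
        (\<forall>\<mu>\<in>\<Lambda>. bij_betw (\<lambda>c. restrict (act (\<Delta> \<mu>) (scale c 1)) (car (\<Delta> \<mu>))) UNIV (endos (\<Delta> \<mu>))) \<and>
        (\<forall>\<mu>\<in>\<Lambda>. \<forall>\<nu>\<in>\<Lambda>. (\<exists>f\<in>mhom (\<Delta> \<mu>) (\<Delta> \<nu>). \<exists>x\<in>car (\<Delta> \<mu>). f x \<noteq> 0) \<longrightarrow> (\<mu>, \<nu>) \<in> r))"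

section \<open>Every finite-dimensional module lives in the universe\<close>

definition transport ::
  "('a, 'm::ab_group_add) gmod \<Rightarrow> ('m \<Rightarrow> 'n::ab_group_add) \<Rightarrow> ('a, 'n) gmod" where
  "transport M h =
     \<lparr>car = h ` car M, act = (\<lambda>a v. h (act M a (inv_into (car M) h v))), gcomp = (\<lambda>j. h ` gcomp M j)\<rparr>"

lemma amodule_zero_act:
  assumes "amodule M" "x \<in> car M"
  shows "act M 0 x = 0"
proof -
  have "act M (0 + 0) x = act M 0 x + act M 0 x"
    using assms unfolding amodule_def by blast
  then show ?thesis by simp
qed

lemma amodule_sum_closed:
  assumes "amodule M" "\<And>i. i \<in> S \<Longrightarrow> g i \<in> car M"
  shows "sum g S \<in> car M"
  using assms(2)
  by (induction S rule: infinite_finite_induct) (use assms(1) in \<open>auto simp: amodule_def\<close>)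

lemma amodule_act_sum:
  assumes "amodule M" "\<And>i. i \<in> S \<Longrightarrow> g i \<in> car M"
  shows "act M a (sum g S) = (\<Sum>i\<in>S. act M a (g i))"
proof -
  have z: "act M a 0 = 0"
  proof -
    have "act M a (0 + 0) = act M a 0 + act M a 0"
      using assms(1) unfolding amodule_def by blast
    then show ?thesis by simp
  qed
  show ?thesis
    using assms(2)
  proof (induction S rule: infinite_finite_induct)
    case (insert i S)
    have "act M a (g i + sum g S) = act M a (g i) + act M a (sum g S)"
      using assms(1) insert.prems amodule_sum_closed[OF assms(1), of S g] unfolding amodule_def by blast
    then show ?case using insert by simp
  qed (auto simp: z)
qed

lemma fin_dim_embedding:
  fixes scale :: "'k::field \<Rightarrow> 'a::ring_1 \<Rightarrow> 'a" and M :: "('a, 'm::ab_group_add, 'z) amod_scheme"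
  assumes A: "fd_algebra scale" and M: "amodule M" and fd: "fin_dim scale M"
  obtains h :: "'m \<Rightarrow> nat \<Rightarrow> 'k"
  where "inj_on h (car M)" "\<And>x y. x \<in> car M \<Longrightarrow> y \<in> car M \<Longrightarrow> h (x + y) = h x + h y"
proof -
  interpret fd_algebra scale by (fact A)
  define sc where "sc c x = act M (scale c 1) x" for c x
  have sc_closed: "sc c x \<in> car M" if "x \<in> car M" for c x
    using M that unfolding amodule_def sc_def by blast
  have sc_add: "sc (c + c') x = sc c x + sc c' x" if "x \<in> car M" for c c' x
    using M that unfolding amodule_def sc_def by (metis scale_left_distrib)
  have sc_plus: "sc c (x + y) = sc c x + sc c y" if "x \<in> car M" "y \<in> car M" for c x y
    using M that unfolding amodule_def sc_def by blast
  have sc_mult: "sc (c * c') x = sc c (sc c' x)" if "x \<in> car M" for c c' x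
  proof -
    have "scale (c * c') 1 = scale c 1 * scale c' 1"
      by (simp add: scale_mult_left)
    then show ?thesis
      using M that unfolding amodule_def sc_def by simp
  qed
  have sc_one: "sc 1 x = x" if "x \<in> car M" for x
    using M that unfolding amodule_def sc_def by simp
  have sc_zero: "sc 0 x = 0" if "x \<in> car M" for x
    using amodule_zero_act[OF M that] by (simp add: sc_def)
  define spans where "spans B \<longleftrightarrow> finite B \<and> B \<subseteq> car M \<and> (\<forall>x\<in>car M. \<exists>c. x = (\<Sum>b\<in>B. sc (c b) b))" for B
  have "\<exists>B. spans B"
    using fd unfolding fin_dim_def spans_def sc_def .
  then obtain B0 where "spans B0" ..
  from ex_has_least_nat[of spans, OF this, of card]
  obtain B where B: "spans B" and least: "\<And>B'. spans B' \<Longrightarrow> card B \<le> card B'"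
    by blast
  have fin: "finite B" and sub: "B \<subseteq> car M"
    using B by (auto simp: spans_def)
  have indep: "c b = 0" if s0: "(\<Sum>b\<in>B. sc (c b) b) = 0" and b: "b \<in> B" for c b
  proof (rule ccontr)
    assume cb: "c b \<noteq> 0"
    let ?B = "B - {b}"
    let ?q = "- inverse (c b)"
    have cl: "\<And>i. i \<in> ?B \<Longrightarrow> sc (c i) i \<in> car M"
      using sub sc_closed by blast
    have bM: "b \<in> car M" using b sub by blast
    have inB: "sum (\<lambda>i. sc (c i) i) ?B \<in> car M"
      by (rule amodule_sum_closed[OF M]) (rule cl)
    have split: "sc (c b) b + (\<Sum>i\<in>?B. sc (c i) i) = 0"
      using s0 fin b by (simp add: sum.remove)
    have q0: "sc ?q 0 = 0"
      using amodule_act_sum[OF M, of "{}"] by (simp add: sc_def)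
    have q1: "sc ?q (sc (c b) b) = sc (-1) b"
      using cb sc_mult[OF bM, of ?q "c b"] by simp
    have q2: "sc (-1) b + b = 0"
      using sc_add[OF bM, of "-1" 1] sc_one[OF bM] sc_zero[OF bM] by simp
    have q3: "sc ?q (\<Sum>i\<in>?B. sc (c i) i) = (\<Sum>i\<in>?B. sc (?q * c i) i)"
    proof -
      have "sc ?q (\<Sum>i\<in>?B. sc (c i) i) = (\<Sum>i\<in>?B. sc ?q (sc (c i) i))"
        unfolding sc_def by (rule amodule_act_sum[OF M]) (use cl in \<open>simp add: sc_def\<close>)
      also have "\<dots> = (\<Sum>i\<in>?B. sc (?q * c i) i)"
        using sub by (intro sum.cong refl sc_mult[symmetric]) auto
      finally show ?thesis .
    qed
    have "sc (-1) b + (\<Sum>i\<in>?B. sc (?q * c i) i)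
        = sc ?q (sc (c b) b) + sc ?q (\<Sum>i\<in>?B. sc (c i) i)"
      by (simp only: q1 q3)
    also have "\<dots> = sc ?q (sc (c b) b + (\<Sum>i\<in>?B. sc (c i) i))"
      by (rule sc_plus[OF sc_closed[OF bM] inB, symmetric])
    also have "\<dots> = sc (-1) b + b"
      by (simp only: split q0 q2)
    finally have b_eq: "b = (\<Sum>i\<in>?B. sc (?q * c i) i)"
      by (rule add_left_imp_eq[symmetric])
    have "spans ?B"
      unfolding spans_def
    proof (intro conjI ballI)
      fix x assume "x \<in> car M"
      then obtain g where x: "x = (\<Sum>i\<in>B. sc (g i) i)"
        using B by (auto simp: spans_def)
      have cl2: "\<And>i. i \<in> ?B \<Longrightarrow> sc (?q * c i) i \<in> car M"
        using sub sc_closed by blast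
      have "sc (g b) b = sc (g b) (\<Sum>i\<in>?B. sc (?q * c i) i)"
        using b_eq by (rule arg_cong)
      also have "\<dots> = (\<Sum>i\<in>?B. sc (g b) (sc (?q * c i) i))"
        unfolding sc_def by (rule amodule_act_sum[OF M]) (use cl2 in \<open>simp add: sc_def\<close>)
      also have "\<dots> = (\<Sum>i\<in>?B. sc (g b * (?q * c i)) i)"
        using sub by (intro sum.cong refl sc_mult[symmetric]) auto
      finally have "x = (\<Sum>i\<in>?B. sc (g b * (?q * c i)) i) + (\<Sum>i\<in>?B. sc (g i) i)"
        using x fin b by (simp add: sum.remove)
      also have "\<dots> = (\<Sum>i\<in>?B. sc (g b * (?q * c i) + g i) i)"
        unfolding sum.distrib[symmetric] using sub by (intro sum.cong refl sc_add[symmetric]) auto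
      finally show "\<exists>g. x = (\<Sum>i\<in>?B. sc (g i) i)"
        by (intro exI[of _ "\<lambda>i. g b * (?q * c i) + g i"])
    qed (use fin sub in auto)
    then have "card B \<le> card ?B" by (rule least)
    then show False
      using fin b by (metis card_Diff1_less not_le)
  qed
  define co where "co x = (SOME c. x = (\<Sum>b\<in>B. sc (c b) b))" for x
  have co: "x = (\<Sum>b\<in>B. sc (co x b) b)" if "x \<in> car M" for x
  proof -
    have "\<exists>c. x = (\<Sum>b\<in>B. sc (c b) b)"
      using B that unfolding spans_def by blast
    from someI_ex[OF this] show ?thesis unfolding co_def .
  qed
  have co_add: "co (x + y) b = co x b + co y b" if x: "x \<in> car M" and y: "y \<in> car M" and b: "b \<in> B" for x y b
  proof -
    have xy: "x + y \<in> car M" using M x y by (auto simp: amodule_def)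
    have "(\<Sum>b\<in>B. sc (co (x + y) b - (co x b + co y b)) b) + (\<Sum>b\<in>B. sc (co x b + co y b) b)
        = (\<Sum>b\<in>B. sc (co (x + y) b) b)"
      unfolding sum.distrib[symmetric]
      using sub by (intro sum.cong refl) (auto simp: sc_add[symmetric])
    moreover have "(\<Sum>b\<in>B. sc (co x b + co y b) b) = (\<Sum>b\<in>B. sc (co x b) b) + (\<Sum>b\<in>B. sc (co y b) b)"
      unfolding sum.distrib[symmetric] using sub by (intro sum.cong refl sc_add) auto
    ultimately have "(\<Sum>b\<in>B. sc (co (x + y) b - (co x b + co y b)) b) = 0"
      by (simp only: co[OF x, symmetric] co[OF y, symmetric] co[OF xy, symmetric] add_cancel_left_left)
    from indep[OF this b] show ?thesis by simp
  qed
  obtain en where en: "bij_betw en {..<card B} B"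
    using ex_bij_betw_nat_finite[OF fin] by (auto simp: lessThan_atLeast0)
  define h where "h x i = (if i < card B then co x (en i) else 0)" for x and i :: nat
  show thesis
  proof
    show "inj_on h (car M)"
    proof (rule inj_onI)
      fix x y assume x: "x \<in> car M" and y: "y \<in> car M" and hxy: "h x = h y"
      have "co x b = co y b" if "b \<in> B" for b
      proof -
        obtain i where i: "i < card B" "b = en i"
          using en \<open>b \<in> B\<close> by (auto simp: bij_betw_def)
        then show ?thesis using fun_cong[OF hxy, of i] by (simp add: h_def)
      qed
      then have "(\<Sum>b\<in>B. sc (co x b) b) = (\<Sum>b\<in>B. sc (co y b) b)"
        by simp
      then show "x = y"
        using co[OF x, symmetric] co[OF y, symmetric] by (simp only:)
    qed
    show "h (x + y) = h x + h y" if "x \<in> car M" "y \<in> car M" for x y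
    proof
      fix i
      have "en i \<in> B" if "i < card B"
        using en that by (auto simp: bij_betw_def)
      then show "h (x + y) i = (h x + h y) i"
        using co_add[OF that] by (simp add: h_def)
    qed
  qed
qed

lemma transport_props:
  fixes h :: "'m::ab_group_add \<Rightarrow> 'n::ab_group_add" and M :: "('a::ring_1, 'm) gmod"
  assumes M: "amodule M" and inj: "inj_on h (car M)"
    and add: "\<And>x y. x \<in> car M \<Longrightarrow> y \<in> car M \<Longrightarrow> h (x + y) = h x + h y"
  shows transport_act: "x \<in> car M \<Longrightarrow> act (transport M h) a (h x) = h (act M a x)"
    and transport_amodule: "amodule (transport M h)"
    and transport_mhom: "h \<in> mhom M (transport M h)"
    and transport_bij: "bij_betw h (car M) (car (transport M h))"
    and transport_sum: "(\<And>i. i \<in> S \<Longrightarrow> g i \<in> car M) \<Longrightarrow> h (sum g S) = (\<Sum>i\<in>S. h (g i))"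
    and transport_zero: "h 0 = 0"
proof -
  note m = M[unfolded amodule_def]
  have act: "act (transport M h) a (h x) = h (act M a x)" if "x \<in> car M" for a x
    using inj that by (simp add: transport_def)
  have car: "car (transport M h) = h ` car M" by (simp add: transport_def)
  have "h (0 + 0) = h 0 + h 0" by (rule add) (use m in auto)
  then show z: "h 0 = 0" by simp
  show "x \<in> car M \<Longrightarrow> act (transport M h) a (h x) = h (act M a x)" by (rule act)
  show "amodule (transport M h)"
    unfolding amodule_def car
    using m z by (auto simp: act add[symmetric] intro!: image_eqI[of 0 h 0])
  show "h \<in> mhom M (transport M h)"
    using m by (auto simp: mhom_def car act add)
  show "bij_betw h (car M) (car (transport M h))"
    using inj by (simp add: bij_betw_def car)
  show "h (sum g S) = (\<Sum>i\<in>S. h (g i))" if "\<And>i. i \<in> S \<Longrightarrow> g i \<in> car M"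
    using that
  proof (induction S rule: infinite_finite_induct)
    case (insert i S)
    have "h (g i + sum g S) = h (g i) + h (sum g S)"
      by (rule add) (use insert.prems amodule_sum_closed[OF M, of S g] in auto)
    then show ?case using insert by simp
  qed (auto simp: z)
qed

lemma transport_fin_dim:
  fixes h :: "'m::ab_group_add \<Rightarrow> 'n::ab_group_add" and M :: "('a::ring_1, 'm) gmod"
  assumes M: "amodule M" and inj: "inj_on h (car M)"
    and add: "\<And>x y. x \<in> car M \<Longrightarrow> y \<in> car M \<Longrightarrow> h (x + y) = h x + h y"
    and fd: "fin_dim scale M"
  shows "fin_dim scale (transport M h)"
proof -
  note tp = transport_props[OF M inj add]
  obtain B where B: "finite B" "B \<subseteq> car M" and sp: "\<forall>x\<in>car M. \<exists>c. x = (\<Sum>b\<in>B. act M (scale (c b) 1) b)"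
    using fd unfolding fin_dim_def by blast
  have "\<exists>c. h x = (\<Sum>v\<in>h ` B. act (transport M h) (scale (c v) 1) v)" if x: "x \<in> car M" for x
  proof -
    obtain c where c: "x = (\<Sum>b\<in>B. act M (scale (c b) 1) b)" using sp x by blast
    have "h x = (\<Sum>b\<in>B. h (act M (scale (c b) 1) b))"
      unfolding c by (rule tp(5)) (use M B in \<open>auto simp: amodule_def\<close>)
    also have "\<dots> = (\<Sum>b\<in>B. act (transport M h) (scale (c b) 1) (h b))"
      using B tp(1) by (intro sum.cong) auto
    also have "\<dots> = (\<Sum>v\<in>h ` B. act (transport M h) (scale (c (inv_into (car M) h v)) 1) v)"
      using B inj inj_on_subset[OF inj, of B]
      by (subst sum.reindex) (auto intro!: sum.cong simp: subset_iff)
    finally show ?thesis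
      by (intro exI[of _ "\<lambda>v. c (inv_into (car M) h v)"])
  qed
  then show ?thesis
    unfolding fin_dim_def using B by (intro exI[of _ "h ` B"]) (auto simp: transport_def)
qed

lemma transport_direct_sum:
  fixes h :: "'m::ab_group_add \<Rightarrow> 'n::ab_group_add"
  assumes inj: "inj_on h V" and zero: "h 0 = 0" "0 \<in> V"
    and sum: "\<And>(g :: 'i \<Rightarrow> 'm) S. (\<And>i. i \<in> S \<Longrightarrow> g i \<in> V) \<Longrightarrow> h (sum g S) = (\<Sum>i\<in>S. h (g i))"
    and sub: "\<And>i. C i \<subseteq> V" and ds: "internal_direct_sum V UNIV C"
  shows "internal_direct_sum (h ` V) (UNIV :: 'i set) (\<lambda>i. h ` C i)"
proof -
  define F where "F = {f. (\<forall>i. f i \<in> C i) \<and> finite {i. f i \<noteq> 0}}"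
  define G where "G = {f. (\<forall>i. f i \<in> h ` C i) \<and> finite {i. f i \<noteq> 0}}"
  have nz: "h x \<noteq> 0 \<longleftrightarrow> x \<noteq> 0" if "x \<in> V" for x
    using inj zero that by (metis inj_onD)
  have supp: "{i. h (f i) \<noteq> 0} = {i. f i \<noteq> 0}" if "f \<in> F" for f
    using that sub nz by (auto simp: F_def subset_iff)
  have bij1: "bij_betw (\<lambda>f. \<Sum>i | f i \<noteq> 0. f i) F V"
    using ds by (simp add: internal_direct_sum_def F_def)
  have bij2: "bij_betw (\<lambda>f i. h (f i)) F G"
  proof (rule bij_betw_imageI)
    show "inj_on (\<lambda>f i. h (f i)) F"
    proof (rule inj_onI, rule ext)
      fix f g i assume fg: "f \<in> F" "g \<in> F" and eq: "(\<lambda>i. h (f i)) = (\<lambda>i. h (g i))"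
      have "f i \<in> V" "g i \<in> V" using fg sub by (auto simp: F_def subset_iff)
      then show "f i = g i" using fun_cong[OF eq, of i] inj by (auto dest: inj_onD)
    qed
    show "(\<lambda>f i. h (f i)) ` F = G"
    proof (intro equalityI subsetI)
      fix g assume "g \<in> (\<lambda>f i. h (f i)) ` F"
      then obtain f where "f \<in> F" "g = (\<lambda>i. h (f i))" by blast
      then show "g \<in> G" using supp[of f] by (auto simp: G_def F_def)
    next
      fix g assume g: "g \<in> G"
      then obtain f where f: "\<And>i. f i \<in> C i" "\<And>i. g i = h (f i)"
        unfolding G_def image_iff by (auto dest!: choice simp: Bex_def)
      have "f i \<in> V" for i using f(1) sub by blast
      then have "{i. f i \<noteq> 0} = {i. g i \<noteq> 0}"
        using f(2) nz by simp
      then have "f \<in> F" using f g by (auto simp: F_def G_def)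
      then show "g \<in> (\<lambda>f i. h (f i)) ` F" using f(2) by (auto intro!: image_eqI[of _ _ f])
    qed
  qed
  have "bij_betw (\<lambda>f. \<Sum>i | f i \<noteq> 0. f i) G (h ` V)"
  proof -
    have "bij_betw ((\<lambda>f. \<Sum>i | f i \<noteq> 0. f i) \<circ> (\<lambda>f i. h (f i))) F (h ` V)"
    proof (subst bij_betw_cong)
      show "bij_betw (h \<circ> (\<lambda>f. \<Sum>i | f i \<noteq> 0. f i)) F (h ` V)"
        using bij1 inj by (intro bij_betw_trans[OF bij1]) (auto simp: bij_betw_def)
      show "((\<lambda>f. \<Sum>i | f i \<noteq> 0. f i) \<circ> (\<lambda>f i. h (f i))) f = (h \<circ> (\<lambda>f. \<Sum>i | f i \<noteq> 0. f i)) f"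
        if "f \<in> F" for f
        using that sub by (simp add: supp[OF that]) (subst sum, auto simp: F_def subset_iff)
    qed
    then show ?thesis
      using bij2 bij_betw_comp_iff[OF bij2] by blast
  qed
  then show ?thesis by (simp add: internal_direct_sum_def G_def)
qed

lemma internal_direct_sum_component:
  assumes ds: "internal_direct_sum V UNIV C" and zero: "\<And>i. 0 \<in> C i"
  shows "C i \<subseteq> V"
proof
  fix x assume x: "x \<in> C i"
  let ?f = "(\<lambda>_. 0)(i := x)"
  have "(\<Sum>j | ?f j \<noteq> 0. ?f j) = x"
    by (cases "x = 0") (auto simp: if_distrib cong: if_cong)
  moreover have "(\<Sum>j | ?f j \<noteq> 0. ?f j) \<in> V"
    using ds unfolding internal_direct_sum_def
    by (rule bij_betw_apply) (use x zero in auto)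
  ultimately show "x \<in> V" by simp
qed

lemma gmodule_universe:
  fixes scale :: "'k::field \<Rightarrow> 'a::ring_1 \<Rightarrow> 'a" and M :: "('a, 'm::ab_group_add) gmod"
  assumes A: "fd_algebra scale" and M: "gmodule scale gr M"
  obtains N :: "('a, nat \<Rightarrow> 'k) gmod" where "gmodule scale gr N" "gmod_iso M N"
proof -
  have mod: "amodule M" and fd: "fin_dim scale M"
    using M by (auto simp: gmodule_def)
  obtain h :: "'m \<Rightarrow> nat \<Rightarrow> 'k" where inj: "inj_on h (car M)"
    and add: "\<And>x y. x \<in> car M \<Longrightarrow> y \<in> car M \<Longrightarrow> h (x + y) = h x + h y"
    using fin_dim_embedding[OF A mod fd] by blast
  note tp = transport_props[OF mod inj add]
  have ds: "internal_direct_sum (car M) UNIV (gcomp M)" and z: "\<And>j. 0 \<in> gcomp M j"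
    using M by (auto simp: gmodule_def)
  have sub: "gcomp M j \<subseteq> car M" for j
    by (rule internal_direct_sum_component[OF ds z])
  have ds': "internal_direct_sum (h ` car M) UNIV (\<lambda>j. h ` gcomp M j)"
    by (rule transport_direct_sum[OF inj tp(6) _ tp(5) sub ds]) (use mod in \<open>auto simp: amodule_def\<close>)
  have act: "act (transport M h) a (h x) = h (act M a x)" if "x \<in> gcomp M j" for a x j
    using tp(1) sub that by blast
  have comp: "gcomp (transport M h) j = h ` gcomp M j" for j
    by (simp add: transport_def)
  have addc: "h x + h y = h (x + y)" if "x \<in> gcomp M j" "y \<in> gcomp M j" for x y j
    using add sub that by (metis subsetD)
  have "gmodule scale gr (transport M h)"
    unfolding gmodule_def
  proof (intro conjI allI ballI)
    show "internal_direct_sum (car (transport M h)) UNIV (gcomp (transport M h))"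
      using ds' by (simp add: transport_def)
    fix j
    show "0 \<in> gcomp (transport M h) j"
      using z tp(6) unfolding comp by (metis image_eqI)
    show "v + w \<in> gcomp (transport M h) j"
      if "v \<in> gcomp (transport M h) j" "w \<in> gcomp (transport M h) j" for v w
      using that M unfolding comp gmodule_def by (auto simp: addc)
    show "act (transport M h) (scale c 1) v \<in> gcomp (transport M h) j"
      if "v \<in> gcomp (transport M h) j" for c v
      using that M unfolding comp gmodule_def by (auto simp: act)
    show "act (transport M h) a v \<in> gcomp (transport M h) (i + j)"
      if "a \<in> gr i" "v \<in> gcomp (transport M h) j" for i a v
      using that M unfolding comp gmodule_def by (auto simp: act)
  qed (use tp(2) transport_fin_dim[OF mod inj add fd] in auto)
  moreover have "gmod_iso M (transport M h)"
    unfolding gmod_iso_def using tp(3,4) comp by blast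
  ultimately show thesis by (rule that)
qed

lemma fin_dim_module_universe:
  fixes scale :: "'k::field \<Rightarrow> 'a::ring_1 \<Rightarrow> 'a" and M :: "('a, 'm::ab_group_add) amod"
  assumes A: "fd_algebra scale" and mod: "amodule M" and fd: "fin_dim scale M"
  obtains N :: "('a, nat \<Rightarrow> 'k) amod" where "amodule N" "fin_dim scale N" "mod_iso M N"
proof -
  obtain h :: "'m \<Rightarrow> nat \<Rightarrow> 'k" where inj: "inj_on h (car M)"
    and add: "\<And>x y. x \<in> car M \<Longrightarrow> y \<in> car M \<Longrightarrow> h (x + y) = h x + h y"
    using fin_dim_embedding[OF A mod fd] by blast
  define G :: "('a, 'm) gmod" where "G = \<lparr>car = car M, act = act M, gcomp = (\<lambda>_. {})\<rparr>"
  have G: "amodule G" "fin_dim scale G" "inj_on h (car G)"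
    using mod fd inj by (auto simp: G_def amodule_def fin_dim_def)
  have add': "\<And>x y. x \<in> car G \<Longrightarrow> y \<in> car G \<Longrightarrow> h (x + y) = h x + h y"
    using add by (simp add: G_def)
  define N where "N = \<lparr>car = car (transport G h), act = act (transport G h)\<rparr>"
  note tp = transport_props[OF G(1,3) add']
  have "amodule N" using tp(2) by (simp add: N_def amodule_def)
  moreover have "fin_dim scale N"
    using transport_fin_dim[OF G(1,3) add' G(2)] by (simp add: N_def fin_dim_def)
  moreover have "mod_iso M N"
    unfolding mod_iso_def using tp(3,4) by (intro bexI[of _ h]) (auto simp: N_def G_def mhom_def)
  ultimately show thesis by (rule that)
qed

end

theory Submission
  imports Defs
begin

text \<open>
  Let \<open>Ae = \<Oplus> A\<epsilon>\<^sub>\<mu>\<close> be the decomposition given by \<open>Ae \<simeq> \<Oplus> P\<^sup>\<mu>\<close>, with orthogonal idempotents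
  \<open>\<epsilon>\<^sub>\<mu>\<close> of degree 0. If \<open>w \<in> \<epsilon>\<^sub>\<lambda>A\<epsilon>\<^sub>\<mu>\<close> is nonzero of degree \<open>k\<close>, then \<open>Aw\<close> contains the simple
  socle \<open>L\<^sup>\<mu>\<langle>d\<^sub>\<mu>\<rangle>\<close> of \<open>A\<epsilon>\<^sub>\<mu>\<close>, so \<open>\<epsilon>\<^sub>\<mu>A\<epsilon>\<^sub>\<lambda>\<close> is nonzero in degree \<open>d\<^sub>\<mu> - k\<close>. Applying this twice,
  the set of degrees in which \<open>\<epsilon>\<^sub>\<lambda>A\<epsilon>\<^sub>\<mu>\<close> is nonzero is stable under translation by \<open>d\<^sub>\<lambda> - d\<^sub>\<mu>\<close>. It is
  finite, so it is empty unless \<open>d\<^sub>\<lambda> = d\<^sub>\<mu>\<close>. Hence the sum \<open>f\<close> of the \<open>\<epsilon>\<^sub>\<mu>\<close> with a given value of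
  \<open>d\<^sub>\<mu>\<close> commutes with \<open>eAe\<close>, and by the double centralizer property \<open>x \<mapsto> xf\<close> is the action of a
  central idempotent of \<open>A\<close>, which separates the blocks of the \<open>L\<^sup>\<mu>\<close> with different \<open>d\<^sub>\<mu>\<close>.
\<close>

section \<open>Modules, homomorphisms and graded components\<close>

lemma amoduleD:
  assumes "amodule M"
  shows "0 \<in> car M"
    and "x \<in> car M \<Longrightarrow> y \<in> car M \<Longrightarrow> x + y \<in> car M"
    and "x \<in> car M \<Longrightarrow> act M a x \<in> car M"
    and "x \<in> car M \<Longrightarrow> y \<in> car M \<Longrightarrow> act M a (x + y) = act M a x + act M a y"
    and "x \<in> car M \<Longrightarrow> act M (a + b) x = act M a x + act M b x"
    and "x \<in> car M \<Longrightarrow> act M (a * b) x = act M a (act M b x)"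
    and "x \<in> car M \<Longrightarrow> act M 1 x = x"
    and "act M a 0 = 0"
proof -
  show "act M a 0 = 0"
    using amodule_act_sum[OF assms, of "{}"] by simp
qed (use assms in \<open>auto simp: amodule_def\<close>)

lemma amodule_act_diff:
  assumes "amodule M" "x \<in> car M"
  shows "act M (a - b) x = act M a x - act M b x"
  using amoduleD(5)[OF assms, of "a - b" b] by simp

lemma amodule_sum_act:
  assumes "amodule M" "x \<in> car M"
  shows "act M (sum g S) x = (\<Sum>i\<in>S. act M (g i) x)"
  by (induction S rule: infinite_finite_induct)
    (simp_all add: amodule_zero_act[OF assms] amoduleD(5)[OF assms])

lemma mhomD:
  assumes "f \<in> mhom M N"
  shows "x \<in> car M \<Longrightarrow> f x \<in> car N"
    and "x \<in> car M \<Longrightarrow> y \<in> car M \<Longrightarrow> f (x + y) = f x + f y"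
    and "x \<in> car M \<Longrightarrow> f (act M a x) = act N a (f x)"
  using assms by (auto simp: mhom_def)

lemma mhom_zero:
  assumes "f \<in> mhom M N" "amodule M"
  shows "f 0 = 0"
  using mhomD(2)[OF assms(1), of 0 0] amoduleD(1)[OF assms(2)] by simp

lemma submodule_image:
  assumes f: "f \<in> mhom M N" and M: "amodule M" and S: "submodule M S"
  shows "submodule N (f ` S)"
  unfolding submodule_def
proof (intro conjI ballI allI)
  have sub: "S \<subseteq> car M" using S by (simp add: submodule_def)
  show "f ` S \<subseteq> car N" using sub mhomD(1)[OF f] by auto
  show "0 \<in> f ` S" using S mhom_zero[OF f M] by (metis image_eqI submodule_def)
  show "x + y \<in> f ` S" if xy: "x \<in> f ` S" "y \<in> f ` S" for x y
  proof -
    obtain x' y' where "x' \<in> S" "y' \<in> S" "x = f x'" "y = f y'" using xy by blast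
    moreover from this have "f (x' + y') = x + y" "x' + y' \<in> S"
      using mhomD(2)[OF f] sub S by (auto simp: submodule_def)
    ultimately show ?thesis by (metis image_eqI)
  qed
  show "act N a x \<in> f ` S" if x: "x \<in> f ` S" for a x
  proof -
    obtain x' where "x' \<in> S" "x = f x'" using x by blast
    moreover from this have "f (act M a x') = act N a x" "act M a x' \<in> S"
      using mhomD(3)[OF f] sub S by (auto simp: submodule_def)
    ultimately show ?thesis by (metis image_eqI)
  qed
qed

lemma internal_direct_sum_decompose:
  assumes "internal_direct_sum V UNIV C" "x \<in> V"
  obtains f where "\<And>i. f i \<in> C i" "finite {i. f i \<noteq> 0}" "x = (\<Sum>i | f i \<noteq> 0. f i)"
proof -
  have "x \<in> (\<lambda>f. \<Sum>i | f i \<noteq> 0. f i) `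
      {f. (\<forall>i\<in>UNIV. f i \<in> C i) \<and> (\<forall>i. i \<notin> UNIV \<longrightarrow> f i = 0) \<and> finite {i. f i \<noteq> 0}}"
    using assms unfolding internal_direct_sum_def bij_betw_def by simp
  then show thesis using that by auto
qed

text \<open>The family with the whole sum at index \<open>n\<close> and 0 elsewhere decomposes the
  same element as \<open>g\<close>, and the canonical map is injective.\<close>

lemma internal_direct_sum_unique:
  assumes ds: "internal_direct_sum V UNIV C" and zero: "\<And>i. 0 \<in> C i"
    and g: "\<And>i. g i \<in> C i" and fin: "finite {i. g i \<noteq> 0}"
    and sum: "(\<Sum>i | g i \<noteq> 0. g i) \<in> C n"
  shows "g n = (\<Sum>i | g i \<noteq> 0. g i)"
proof -
  let ?s = "\<Sum>i | g i \<noteq> 0. g i"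
  let ?h = "(\<lambda>_. 0)(n := ?s)"
  have "(\<Sum>i | ?h i \<noteq> 0. ?h i) = ?s"
    by (cases "?s = 0") (auto simp: if_distrib cong: if_cong)
  moreover have "inj_on (\<lambda>f. \<Sum>i | f i \<noteq> 0. f i)
      {f. (\<forall>i\<in>UNIV. f i \<in> C i) \<and> (\<forall>i. i \<notin> UNIV \<longrightarrow> f i = 0) \<and> finite {i. f i \<noteq> 0}}"
    using ds unfolding internal_direct_sum_def bij_betw_def by simp
  ultimately have "?h = g"
    by (elim inj_onD) (use zero g fin sum in auto)
  then show ?thesis by (metis fun_upd_same)
qed

section \<open>Simple submodules and the socle\<close>

text \<open>A nonzero submodule of least dimension inside \<open>N\<close> is simple. Dimension is
  measured in the algebra: submodules of the cyclic module are pulled back along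
  \<open>\<lambda>a. act M a v\<close> to subspaces.\<close>

lemma ex_simple_submodule:
  fixes scale :: "'k::field \<Rightarrow> 'a::ring_1 \<Rightarrow> 'a" and M :: "('a, 'm::ab_group_add, 'z) amod_scheme"
  assumes A: "fd_algebra scale" and M: "amodule M" and v: "v \<in> car M"
    and cyclic: "car M = range (\<lambda>a. act M a v)"
    and N: "submodule M N" "N \<noteq> {0}"
  obtains S where "simple_submodule M S" "S \<subseteq> N"
proof -
  interpret fd_algebra scale by (fact A)
  obtain B where "finite B" "span B = UNIV"
    using finite_dimensional by blast
  moreover obtain B' where "B' \<subseteq> B" "independent B'" "B \<subseteq> span B'"
    by (rule maximal_independent_subset)
  ultimately have B': "finite B'" "independent B'" "span B' = UNIV"
    using finite_subset span_minimal[OF _ subspace_span] by blast+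
  interpret finite_dimensional_vector_space scale B'
    using B' by unfold_locales auto
  \<comment> \<open>The preimage of \<open>S\<close> in the algebra; the annihilator of
    \<open>v\<close> is the case \<open>S = {0}\<close>.\<close>
  define ann where "ann S = {a. act M a v \<in> S}" for S
  have sub: "subspace (ann S)" if "submodule M S" for S
  proof -
    have "act M (scale c x) v = act M (scale c 1) (act M x v)" for c x
      using amoduleD(6)[OF M v, of "scale c 1" x] by (simp add: scale_mult_left)
    then show ?thesis
      using that amodule_zero_act[OF M v] amoduleD(5)[OF M v]
      by (auto simp: subspace_def ann_def submodule_def)
  qed
  \<comment> \<open>As \<open>v\<close> generates \<open>M\<close>, a submodule can be recovered
    from its preimage.\<close>
  have image: "S = (\<lambda>a. act M a v) ` ann S" if "submodule M S" for S
    using that cyclic by (fastforce simp: ann_def submodule_def)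
  obtain S where S: "submodule M S" "S \<noteq> {0}" "S \<subseteq> N"
    and least: "\<And>S'. submodule M S' \<Longrightarrow> S' \<noteq> {0} \<Longrightarrow> S' \<subseteq> N \<Longrightarrow> dim (ann S) \<le> dim (ann S')"
    using ex_has_least_nat[of "\<lambda>S. submodule M S \<and> S \<noteq> {0} \<and> S \<subseteq> N" N "\<lambda>S. dim (ann S)"] N
    by auto
  have S': "S \<subseteq> car M" using S by (simp add: submodule_def)
  have "simple_module (M\<lparr>car := S\<rparr>)"
    unfolding simple_module_def
  proof (intro conjI allI impI)
    show "amodule (M\<lparr>car := S\<rparr>)"
      using S S' M by (auto simp: amodule_def submodule_def subset_iff)
    show "car (M\<lparr>car := S\<rparr>) \<noteq> {0}" using S by simp
    fix T assume "submodule (M\<lparr>car := S\<rparr>) T"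
    then have T: "submodule M T" "T \<subseteq> S" using S' by (auto simp: submodule_def)
    have "T = S" if "T \<noteq> {0}"
    proof -
      have "ann T = ann S"
      proof (rule subspace_dim_equal[OF sub sub])
        show "dim (ann S) \<le> dim (ann T)" using least T that S by blast
      qed (use T S in \<open>auto simp: ann_def\<close>)
      then show ?thesis using image[OF T(1)] image[OF S(1)] by simp
    qed
    then show "T = {0} \<or> T = car (M\<lparr>car := S\<rparr>)" by auto
  qed
  then show thesis using that S by (auto simp: simple_submodule_def)
qed

lemma socle_contains_simple: "simple_submodule M S \<Longrightarrow> S \<subseteq> soc M"
  by (auto simp: soc_def)

lemma submodule_cyclic:
  assumes "amodule M" "w \<in> car M"
  shows "submodule M (range (\<lambda>a. act M a w))"
  unfolding submodule_def
proof (intro conjI ballI allI)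
  show "range (\<lambda>a. act M a w) \<subseteq> car M" using amoduleD(3)[OF assms] by auto
  show "0 \<in> range (\<lambda>a. act M a w)" using amodule_zero_act[OF assms] by (metis rangeI)
  show "x + y \<in> range (\<lambda>a. act M a w)"
    if "x \<in> range (\<lambda>a. act M a w)" "y \<in> range (\<lambda>a. act M a w)" for x y
    using that by (auto simp: amoduleD(5)[OF assms, symmetric])
  show "act M a x \<in> range (\<lambda>a. act M a w)" if "x \<in> range (\<lambda>a. act M a w)" for a x
    using that by (auto simp: amoduleD(6)[OF assms, symmetric])
qed

text \<open>The simple socle of \<open>P\<close> lives in degree \<open>d\<close> and is met by
  every nonzero cyclic submodule, so \<open>w\<close> of degree \<open>k\<close> is sent into it by
  some element of degree \<open>d - k\<close>. Aiming at the socle element that matches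
  \<open>p v\<close> keeps \<open>\<epsilon>\<close> from killing the result.\<close>

lemma socle_pairing:
  fixes L :: "('a::ring_1, 'm::ab_group_add) gmod" and P :: "('a, 'p::ab_group_add) gmod"
  assumes A: "positively_graded_algebra scale gr"
    and L: "concentrated_in_degree_0 L" "simple_module L"
    and P: "gmodule scale gr P" "v \<in> car P" "car P = range (\<lambda>a. act P a v)"
    and idem: "act P \<epsilon> v = v" "\<epsilon> \<in> gr 0"
    and p: "p \<in> mhom P L" "p ` car P = car L"
    and soc: "gmod_iso (restr P (soc P)) (shift L d)"
    and w: "w \<in> gcomp P k" "w \<noteq> 0"
  obtains a where "a \<in> gr (d - k)" "act P \<epsilon> (act P a w) \<noteq> 0"
proof -
  interpret positively_graded_algebra scale gr by (fact A)
  have mod: "amodule P" and ds: "internal_direct_sum (car P) UNIV (gcomp P)"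
    and zero: "\<And>j. 0 \<in> gcomp P j"
    and gact: "\<And>i j a x. a \<in> gr i \<Longrightarrow> x \<in> gcomp P j \<Longrightarrow> act P a x \<in> gcomp P (i + j)"
    using P(1) by (auto simp: gmodule_def)
  have Lmod: "amodule L" and L0: "car L \<noteq> {0}"
    using L(2) by (auto simp: simple_module_def)
  have wcar: "w \<in> car P"
    using internal_direct_sum_component[OF ds zero] w by blast
  obtain \<sigma> where \<sigma>: "\<sigma> \<in> mhom (restr P (soc P)) (shift L d)" "bij_betw \<sigma> (soc P) (car L)"
    "\<And>j. \<sigma> ` (gcomp P j \<inter> soc P) = gcomp L (j - d)"
    using soc by (auto simp: gmod_iso_def restr_def shift_def)
  have \<sigma>_act: "\<sigma> (act P a x) = act L a (\<sigma> x)" if "x \<in> soc P" for a x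
    using mhomD(3)[OF \<sigma>(1)] that by (simp add: restr_def shift_def)
  obtain S where S: "simple_submodule P S" "S \<subseteq> range (\<lambda>a. act P a w)"
  proof (rule ex_simple_submodule[OF fd_algebra_axioms mod P(2,3) submodule_cyclic[OF mod wcar]])
    show "range (\<lambda>a. act P a w) \<noteq> {0}"
      using w(2) amoduleD(7)[OF mod wcar] by (metis rangeI singletonD)
  qed
  have S': "submodule P S" "S \<noteq> {0}" "S \<subseteq> soc P"
    using S(1) socle_contains_simple[OF S(1)] by (auto simp: simple_submodule_def simple_module_def)
  \<comment> \<open>\<open>v\<close> generates \<open>P\<close>, so \<open>p v = 0\<close> would
    force \<open>p\<close> to vanish; \<open>\<epsilon>\<close> fixes \<open>p v\<close> because it
    fixes \<open>v\<close>.\<close>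
  have pv: "act L \<epsilon> (p v) = p v" "p v \<in> car L" "p v \<noteq> 0"
  proof -
    show "act L \<epsilon> (p v) = p v" using mhomD(3)[OF p(1) P(2)] idem(1) by metis
    show "p v \<in> car L" using mhomD(1)[OF p(1) P(2)] .
    show "p v \<noteq> 0"
    proof
      assume "p v = 0"
      then have "p x = 0" if "x \<in> car P" for x
        using that P(3) mhomD(3)[OF p(1) P(2)] amoduleD(8)[OF Lmod] by auto
      then show False using p(2) L0 amoduleD(1)[OF Lmod] by force
    qed
  qed
  \<comment> \<open>\<open>\<sigma>\<close> is injective on the nonzero \<open>S\<close>, and a
    nonzero submodule of the simple \<open>L\<close> is all of \<open>L\<close>.\<close>
  have "\<sigma> ` S = car L"
  proof -
    have hom: "\<sigma> \<in> mhom (P\<lparr>car := S\<rparr>) L"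
      using \<sigma>(1) S'(3) by (auto simp: mhom_def restr_def shift_def subset_iff Pi_iff)
    have "amodule (P\<lparr>car := S\<rparr>)"
      using S(1) by (simp add: simple_submodule_def simple_module_def)
    moreover have "submodule (P\<lparr>car := S\<rparr>) S"
      using S'(1) by (auto simp: submodule_def)
    ultimately have "submodule L (\<sigma> ` S)" "\<sigma> 0 = 0"
      using submodule_image[OF hom] mhom_zero[OF hom] by auto
    moreover have "\<sigma> ` S \<noteq> {0}"
    proof
      assume z: "\<sigma> ` S = {0}"
      have "x = 0" if "x \<in> S" for x
      proof -
        have "0 \<in> S" using S'(1) by (simp add: submodule_def)
        moreover have "\<sigma> x = \<sigma> 0" using imageI[OF that, of \<sigma>] imageI[OF \<open>0 \<in> S\<close>, of \<sigma>] z by simp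
        ultimately show ?thesis
          using \<sigma>(2) that S'(3) by (meson bij_betw_def inj_onD subsetD)
      qed
      then show False using S'(1,2) by (auto simp: submodule_def)
    qed
    ultimately show ?thesis using L(2) by (auto simp: simple_module_def)
  qed
  then obtain s where s: "s \<in> S" "\<sigma> s = p v" using pv(2) by (metis imageE)
  have s_soc: "s \<in> soc P" using s S' by blast
  obtain b where b: "s = act P b w" using s S by blast
  \<comment> \<open>\<open>L\<close> sits in degree 0, so its shift sits in degree \<open>d\<close>;
    injectivity of \<open>\<sigma>\<close> transfers this to \<open>s\<close>.\<close>
  have "s \<in> gcomp P d"
  proof -
    have "\<sigma> s \<in> \<sigma> ` (gcomp P d \<inter> soc P)"
      using \<sigma>(3)[of d] L(1) s(2) pv(2) by (simp add: concentrated_in_degree_0_def)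
    then show ?thesis
      using \<sigma>(2) s_soc by (auto simp: bij_betw_def dest: inj_onD)
  qed
  then have es: "act P \<epsilon> s \<in> gcomp P d"
    using gact[OF idem(2)] by fastforce
  have es0: "act P \<epsilon> s \<noteq> 0"
  proof
    assume "act P \<epsilon> s = 0"
    moreover have "\<sigma> (act P \<epsilon> s) = p v" using \<sigma>_act[OF s_soc] s(2) pv(1) by simp
    moreover have "\<sigma> (act P 0 s) = 0"
      using \<sigma>_act[OF s_soc, of 0] amodule_zero_act[OF Lmod pv(2)] s(2) by simp
    moreover have "s \<in> car P" using s S' by (auto simp: submodule_def)
    ultimately show False using pv(3) amodule_zero_act[OF mod] by metis
  qed
  obtain f where f: "\<And>i. f i \<in> gr i" "finite {i. f i \<noteq> 0}" "b = (\<Sum>i | f i \<noteq> 0. f i)"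
    using internal_direct_sum_decompose[OF gr_direct_sum] by blast
  \<comment> \<open>The degree \<open>i\<close> part of \<open>\<epsilon> b w\<close>: since
    \<open>\<epsilon>\<close> has degree 0 and \<open>w\<close> has degree \<open>k\<close>, it
    stems from the component of \<open>b\<close> in degree \<open>i - k\<close>.\<close>
  define g where "g i = act P \<epsilon> (act P (f (i - k)) w)" for i
  have g0: "f (i - k) \<noteq> 0" if "g i \<noteq> 0" for i
    using that amodule_zero_act[OF mod wcar] amoduleD(8)[OF mod] by (auto simp: g_def)
  have gc: "g i \<in> gcomp P i" for i
    using gact[OF idem(2) gact[OF f(1) w(1)], of "i - k"] by (simp add: g_def)
  have supp: "{i. g i \<noteq> 0} \<subseteq> (\<lambda>i. i + k) ` {i. f i \<noteq> 0}"
    using g0 by force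
  then have fin: "finite {i. g i \<noteq> 0}"
    using f(2) finite_subset by blast
  have "act P \<epsilon> s = (\<Sum>i | f i \<noteq> 0. g (i + k))"
    unfolding b f(3) amodule_sum_act[OF mod wcar] g_def
    by (simp add: amodule_act_sum[OF mod amoduleD(3)[OF mod wcar]])
  also have "\<dots> = (\<Sum>i\<in>(\<lambda>i. i + k) ` {i. f i \<noteq> 0}. g i)"
    by (subst sum.reindex) (auto simp: inj_on_def)
  \<comment> \<open>The support of \<open>g\<close> may be smaller than the shifted support of
    \<open>f\<close>, as a nonzero \<open>f i\<close> can send \<open>w\<close> to an element killed
    by \<open>\<epsilon>\<close>.\<close>
  also have "\<dots> = (\<Sum>i | g i \<noteq> 0. g i)"
    by (rule sum.mono_neutral_right) (use supp f(2) in auto)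
  finally have sum: "act P \<epsilon> s = (\<Sum>i | g i \<noteq> 0. g i)" .
  \<comment> \<open>The sum is homogeneous of degree \<open>d\<close>, so it equals its component
    there.\<close>
  have "g d = act P \<epsilon> s"
    unfolding sum by (rule internal_direct_sum_unique[OF ds zero gc fin]) (use es sum in simp)
  then show thesis using that[OF f(1)[of "d - k"]] es0 by (simp add: g_def)
qed

section \<open>Orthogonal idempotents from the decomposition of \<open>Ae\<close>\<close>

text \<open>The generators \<open>v \<mu>\<close> realize the isomorphisms \<open>A * \<epsilon> \<mu> \<simeq> P \<mu>\<close>, \<open>a * \<epsilon> \<mu> \<mapsto> a v \<mu>\<close>.\<close>

lemma left_ideal_direct_sum_idempotents:
  fixes P :: "'l \<Rightarrow> ('a::ring_1, 'p::ab_group_add) gmod"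
  assumes P: "\<And>\<mu>. \<mu> \<in> I \<Longrightarrow> gmodule scale gr (P \<mu>)" "\<And>\<mu>. \<mu> \<in> I \<Longrightarrow> car (P \<mu>) \<noteq> {0}"
    and e: "e * e = e" "e \<in> gr 0"
    and iso: "gmod_iso (left_ideal gr e) (direct_sum I P)"
  obtains \<epsilon> v where "finite I" "sum \<epsilon> I = e"
    "\<And>\<mu> \<nu>. \<mu> \<in> I \<Longrightarrow> \<nu> \<in> I \<Longrightarrow> \<epsilon> \<mu> * \<epsilon> \<nu> = (if \<mu> = \<nu> then \<epsilon> \<mu> else 0)"
    "\<And>\<mu>. \<mu> \<in> I \<Longrightarrow> \<epsilon> \<mu> \<in> gr 0" "\<And>\<mu>. \<mu> \<in> I \<Longrightarrow> v \<mu> \<in> gcomp (P \<mu>) 0"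
    "\<And>\<mu>. \<mu> \<in> I \<Longrightarrow> car (P \<mu>) = range (\<lambda>a. act (P \<mu>) a (v \<mu>))"
    "\<And>\<mu> a. \<mu> \<in> I \<Longrightarrow> act (P \<mu>) a (v \<mu>) = 0 \<longleftrightarrow> a * \<epsilon> \<mu> = 0"
proof -
  let ?M = "left_ideal gr e" and ?D = "direct_sum I P"
  have mod: "amodule (P \<mu>)" and z: "0 \<in> gcomp (P \<mu>) j" and sub: "gcomp (P \<mu>) j \<subseteq> car (P \<mu>)"
    if "\<mu> \<in> I" for \<mu> j
  proof -
    have *: "internal_direct_sum (car (P \<mu>)) UNIV (gcomp (P \<mu>))" "\<And>j. 0 \<in> gcomp (P \<mu>) j"
      using P(1)[OF that] by (auto simp: gmodule_def)
    show "amodule (P \<mu>)" "0 \<in> gcomp (P \<mu>) j" "gcomp (P \<mu>) j \<subseteq> car (P \<mu>)"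
      using P(1)[OF that] internal_direct_sum_component[OF *] by (auto simp: gmodule_def)
  qed
  have z': "0 \<in> car (P \<mu>)" if "\<mu> \<in> I" for \<mu> using amoduleD(1)[OF mod[OF that]] .
  obtain \<phi> where \<phi>: "\<phi> \<in> mhom ?M ?D" "bij_betw \<phi> (car ?M) (car ?D)"
    "\<And>j. \<phi> ` gcomp ?M j = gcomp ?D j"
    using iso by (auto simp: gmod_iso_def)
  have carM: "a * e \<in> car ?M" for a by (auto simp: left_ideal_def)
  have M: "x * e = x" "a * x \<in> car ?M" if "x \<in> car ?M" for x a
    using that e(1) by (auto simp: left_ideal_def mult.assoc) (metis mult.assoc)
  have eM: "e \<in> car ?M" using carM[of 1] by simp
  have \<phi>_act: "\<phi> (a * x) = (\<lambda>i. if i \<in> I then act (P i) a (\<phi> x i) else 0)" if "x \<in> car ?M" for a x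
    using mhomD(3)[OF \<phi>(1) that, of a] by (simp add: left_ideal_def direct_sum_def)
  have D: "(\<forall>i\<in>I. x i \<in> car (P i)) \<and> (\<forall>i. i \<notin> I \<longrightarrow> x i = 0) \<and> finite {i. x i \<noteq> 0} \<longleftrightarrow> x \<in> car ?D"
    and Dg: "(\<forall>i\<in>I. x i \<in> gcomp (P i) j) \<and> (\<forall>i. i \<notin> I \<longrightarrow> x i = 0) \<and> finite {i. x i \<noteq> 0}
      \<longleftrightarrow> x \<in> gcomp ?D j" for x j
    by (auto simp: direct_sum_def)
  have \<phi>0: "x = 0" if "x \<in> car ?M" "\<And>i. i \<in> I \<Longrightarrow> \<phi> x i = 0" for x
  proof -
    have "\<phi> x \<in> car ?D" using that mhomD(1)[OF \<phi>(1)] by blast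
    then have "\<phi> x = (\<lambda>_. 0)" using that(2) by (auto simp: D[symmetric])
    moreover have "\<phi> (0 * e) = (\<lambda>_. 0)"
      using \<phi>_act[OF eM, of 0] mhomD(1)[OF \<phi>(1) eM] amodule_zero_act[OF mod] by (auto simp: D[symmetric])
    ultimately have "x = 0 * e"
      using \<phi>(2) carM[of 0] that(1) unfolding bij_betw_def by (metis inj_onD)
    then show ?thesis by simp
  qed
  \<comment> \<open>The components of the image of \<open>e\<close> will generate the summands;
    \<open>\<epsilon> \<mu>\<close> is the element of \<open>Ae\<close> corresponding to the single
    component \<open>v \<mu>\<close>.\<close>
  define v where "v = \<phi> e"
  define \<epsilon> where "\<epsilon> \<mu> = inv_into (car ?M) \<phi> (\<lambda>i. if i = \<mu> then v \<mu> else 0)" for \<mu>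
  have "v \<in> gcomp ?D 0"
    using \<phi>(3)[of 0] e(2) eM by (auto simp: v_def left_ideal_def)
  then have vg: "v \<mu> \<in> gcomp (P \<mu>) 0" if "\<mu> \<in> I" for \<mu> using that by (auto simp: Dg[symmetric])
  have vc: "v \<mu> \<in> car (P \<mu>)" if "\<mu> \<in> I" for \<mu> using vg sub that by blast
  have \<phi>_e: "\<phi> (a * e) i = act (P i) a (v i)" if "i \<in> I" for a i
    using \<phi>_act[OF eM] that by (simp add: v_def)
  have gen: "car (P \<mu>) = range (\<lambda>a. act (P \<mu>) a (v \<mu>))" if \<mu>: "\<mu> \<in> I" for \<mu>
  proof (intro equalityI subsetI)
    fix x assume "x \<in> car (P \<mu>)"
    then have "(\<lambda>i. if i = \<mu> then x else 0) \<in> car ?D"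
      using \<mu> z' by (auto simp: D[symmetric])
    then obtain y where y: "y \<in> car ?M" "\<phi> y = (\<lambda>i. if i = \<mu> then x else 0)"
      using \<phi>(2) by (metis bij_betw_def imageE)
    have "x = act (P \<mu>) y (v \<mu>)" using \<phi>_e[OF \<mu>, of y] M(1)[OF y(1)] y(2) by simp
    then show "x \<in> range (\<lambda>a. act (P \<mu>) a (v \<mu>))" by blast
  qed (use amoduleD(3)[OF mod[OF \<mu>] vc[OF \<mu>]] in auto)
  have v0: "v \<mu> \<noteq> 0" if "\<mu> \<in> I" for \<mu>
    using gen[OF that] P(2)[OF that] amoduleD(8)[OF mod[OF that]] by force
  \<comment> \<open>Elements of the direct sum have finite support, and every \<open>v i\<close>
    with \<open>i \<in> I\<close> is nonzero, so \<open>I\<close> itself is finite.\<close>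
  have "finite {i. v i \<noteq> 0}" using mhomD(1)[OF \<phi>(1) eM] by (auto simp: v_def D[symmetric])
  then have fin: "finite I" by (rule rev_finite_subset) (use v0 in auto)
  have \<epsilon>: "\<epsilon> \<mu> \<in> gr 0" "\<epsilon> \<mu> \<in> car ?M" "\<phi> (\<epsilon> \<mu>) = (\<lambda>i. if i = \<mu> then v \<mu> else 0)"
    if \<mu>: "\<mu> \<in> I" for \<mu>
  proof -
    \<comment> \<open>\<open>\<phi>\<close> maps degree 0 onto degree 0, so a preimage of degree 0
      exists; injectivity identifies it with \<open>\<epsilon> \<mu>\<close>.\<close>
    have "(\<lambda>i. if i = \<mu> then v \<mu> else 0) \<in> \<phi> ` gcomp ?M 0"
      unfolding \<phi>(3) using \<mu> vg z by (auto simp: Dg[symmetric])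
    then obtain x where x: "x \<in> gcomp ?M 0" "\<phi> x = (\<lambda>i. if i = \<mu> then v \<mu> else 0)"
      by (metis (no_types, lifting) imageE)
    have xM: "x \<in> car ?M" using x(1) by (simp add: left_ideal_def)
    have "\<epsilon> \<mu> = x"
      unfolding \<epsilon>_def x(2)[symmetric] using \<phi>(2) xM by (simp add: bij_betw_def)
    then show "\<epsilon> \<mu> \<in> gr 0" "\<epsilon> \<mu> \<in> car ?M" "\<phi> (\<epsilon> \<mu>) = (\<lambda>i. if i = \<mu> then v \<mu> else 0)"
      using x xM by (auto simp: left_ideal_def)
  qed
  have ann: "act (P \<mu>) a (v \<mu>) = 0 \<longleftrightarrow> a * \<epsilon> \<mu> = 0" if \<mu>: "\<mu> \<in> I" for \<mu> a
  proof
    assume "act (P \<mu>) a (v \<mu>) = 0"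
    then show "a * \<epsilon> \<mu> = 0"
      using \<phi>_act[OF \<epsilon>(2)[OF \<mu>], of a] \<epsilon>(3)[OF \<mu>] amoduleD(8)[OF mod]
      by (intro \<phi>0 M(2)[OF \<epsilon>(2)[OF \<mu>]]) auto
  next
    assume 0: "a * \<epsilon> \<mu> = 0"
    have "act (P \<mu>) a (v \<mu>) = \<phi> (a * \<epsilon> \<mu>) \<mu>"
      using \<phi>_act[OF \<epsilon>(2)[OF \<mu>], of a] \<epsilon>(3)[OF \<mu>] \<mu> by simp
    also have "\<dots> = \<phi> (0 * e) \<mu>" by (simp add: 0)
    also have "\<dots> = 0" using \<phi>_e[OF \<mu>, of 0] amodule_zero_act[OF mod vc] \<mu> by simp
    finally show "act (P \<mu>) a (v \<mu>) = 0" .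
  qed
  have \<epsilon>v: "act (P \<nu>) (\<epsilon> \<mu>) (v \<nu>) = (if \<mu> = \<nu> then v \<nu> else 0)" if "\<mu> \<in> I" "\<nu> \<in> I" for \<mu> \<nu>
    using \<phi>_e[OF that(2), of "\<epsilon> \<mu>"] M(1)[OF \<epsilon>(2)[OF that(1)]] \<epsilon>(3)[OF that(1)] by auto
  \<comment> \<open>By \<open>ann\<close>, products with \<open>\<epsilon> \<nu>\<close> on the
    right can be tested on \<open>v \<nu>\<close>, where \<open>\<epsilon> \<nu>\<close> acts as 1
    and the other idempotents as 0.\<close>
  have orth: "\<epsilon> \<mu> * \<epsilon> \<nu> = (if \<mu> = \<nu> then \<epsilon> \<mu> else 0)" if "\<mu> \<in> I" "\<nu> \<in> I" for \<mu> \<nu>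
  proof (cases "\<mu> = \<nu>")
    case True
    have "act (P \<nu>) (\<epsilon> \<nu> - 1) (v \<nu>) = 0"
      using amodule_act_diff[OF mod vc] amoduleD(7)[OF mod vc] \<epsilon>v[of \<nu> \<nu>] that by simp
    then show ?thesis using ann that True by (simp add: left_diff_distrib)
  next
    case False
    then show ?thesis using \<epsilon>v[OF that] ann that by simp
  qed
  \<comment> \<open>Both \<open>sum \<epsilon> I\<close> and \<open>e\<close> act as the identity on
    each \<open>v i\<close>, and \<open>\<phi>0\<close> tests vanishing componentwise.\<close>
  have "sum \<epsilon> I - e = 0"
  proof (rule \<phi>0)
    have *: "sum \<epsilon> I - e = (sum \<epsilon> I - e) * e"
      using M(1)[OF \<epsilon>(2)] e(1) by (simp add: left_diff_distrib sum_distrib_right)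
    show "sum \<epsilon> I - e \<in> car ?M" using * carM by metis
    fix i assume i: "i \<in> I"
    have "\<phi> (sum \<epsilon> I - e) i = act (P i) (sum \<epsilon> I - e) (v i)"
      using \<phi>_e[OF i] * by metis
    also have "\<dots> = (\<Sum>\<mu>\<in>I. act (P i) (\<epsilon> \<mu>) (v i)) - act (P i) e (v i)"
      by (simp add: amodule_act_diff[OF mod vc] amodule_sum_act[OF mod vc] i)
    also have "(\<Sum>\<mu>\<in>I. act (P i) (\<epsilon> \<mu>) (v i)) = (\<Sum>\<mu>\<in>I. if \<mu> = i then v i else 0)"
      using \<epsilon>v i by (intro sum.cong) auto
    also have "\<dots> = v i" using fin i by simp
    also have "act (P i) e (v i) = v i" using \<phi>_e[OF i, of e] e(1) by (simp add: v_def)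
    finally show "\<phi> (sum \<epsilon> I - e) i = 0" by simp
  qed
  then have "sum \<epsilon> I = e" by simp
  from that[OF fin this orth \<epsilon>(1) vg gen ann] show thesis by blast
qed

section \<open>Translations of degrees, central idempotents and blocks\<close>

text \<open>A positive \<open>t\<close> would carry the maximum out of \<open>N\<close>, a negative
  one the minimum.\<close>

lemma no_translation_of_finite_set:
  fixes N :: "int set"
  assumes "finite N" "N \<noteq> {}" "\<And>k. k \<in> N \<Longrightarrow> k + t \<in> N"
  shows "t = 0"
  using Max_ge[OF assms(1) assms(3)[OF Max_in[OF assms(1,2)]]]
    Min_le[OF assms(1) assms(3)[OF Min_in[OF assms(1,2)]]] by simp

text \<open>Endomorphisms of \<open>Ae\<close> are right multiplications by elements of
  \<open>eAe\<close>, so by \<open>comm\<close> they commute with right multiplication by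
  \<open>f\<close>. Surjectivity of the canonical map makes the latter the action of some
  \<open>z\<close>; injectivity reduces the claims on \<open>z\<close> to identities on
  \<open>Ae\<close>.\<close>

lemma double_centralizer_central_idempotent:
  fixes e f :: "'a::ring_1"
  assumes dc: "double_centralizer (left_ideal gr e)"
    and e: "e * e = e" and f: "f * f = f" "f * e = f"
    and comm: "\<And>b. e * b = b \<Longrightarrow> b * e = b \<Longrightarrow> b * f = f * b"
  obtains z where "z * z = z" "\<And>a. z * a = a * z" "\<And>x. x * e = x \<Longrightarrow> z * x = x * f"
proof -
  let ?M = "left_ideal gr e"
  have car: "x \<in> car ?M \<longleftrightarrow> x * e = x" for x
  proof
    show "x * e = x" if "x \<in> car ?M"
      using that e by (auto simp: left_ideal_def mult.assoc)
    show "x \<in> car ?M" if "x * e = x"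
      unfolding left_ideal_def using that[symmetric] by auto
  qed
  have act: "act ?M = (*)" by (simp add: left_ideal_def)
  have add: "x * e = x \<Longrightarrow> y * e = y \<Longrightarrow> (x + y) * e = x + y" for x y
    by (simp add: distrib_right)
  have "restrict (\<lambda>x. x * f) (car ?M) \<in> right_endos ?M"
    unfolding right_endos_def
  proof (intro CollectI conjI ballI)
    show "restrict (\<lambda>x. x * f) (car ?M) \<in> car ?M \<rightarrow>\<^sub>E car ?M"
      by (auto simp: car mult.assoc f)
    fix x assume x: "x \<in> car ?M"
    show "restrict (\<lambda>x. x * f) (car ?M) (x + y)
        = restrict (\<lambda>x. x * f) (car ?M) x + restrict (\<lambda>x. x * f) (car ?M) y"
      if "y \<in> car ?M" for y
      using x that add by (simp add: car distrib_right)
    fix \<phi> assume "\<phi> \<in> endos ?M"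
    then have \<phi>: "\<phi> \<in> mhom ?M ?M" by (simp add: endos_def)
    have eM: "e \<in> car ?M" by (simp add: car e)
    \<comment> \<open>From \<open>y = y * e\<close>, an endomorphism is determined by its value at
      \<open>e\<close>.\<close>
    have \<phi>x: "\<phi> y = y * \<phi> e" if "y \<in> car ?M" for y
      using mhomD(3)[OF \<phi> eM, of y] that by (simp add: act car)
    have b: "\<phi> e * e = \<phi> e" "e * \<phi> e = \<phi> e"
      using mhomD(1)[OF \<phi> eM] \<phi>x[OF eM] by (simp_all add: car)
    have xf: "x * f \<in> car ?M" by (simp add: car mult.assoc f)
    have "\<phi> x * f = x * (\<phi> e * f)" using \<phi>x[OF x] by (simp add: mult.assoc)
    also have "\<dots> = \<phi> (x * f)" using comm[OF b(2,1)] \<phi>x[OF xf] by (simp add: mult.assoc)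
    finally show "restrict (\<lambda>x. x * f) (car ?M) (\<phi> x) = \<phi> (restrict (\<lambda>x. x * f) (car ?M) x)"
      using x mhomD(1)[OF \<phi> x] by simp
  qed
  then obtain z where "restrict (act ?M z) (car ?M) = restrict (\<lambda>x. x * f) (car ?M)"
    using dc unfolding double_centralizer_def bij_betw_def by (metis (no_types, lifting) imageE)
  then have zx: "z * x = x * f" if "x * e = x" for x
    using that by (metis act car restrict_apply')
  have faithful: "a = b" if "\<And>x. x * e = x \<Longrightarrow> a * x = b * x" for a b
  proof -
    have "restrict (act ?M a) (car ?M) = restrict (act ?M b) (car ?M)"
      using that by (intro restrict_ext) (simp add: act car)
    then show ?thesis using dc by (auto simp: double_centralizer_def bij_betw_def dest: injD)
  qed
  have "z * z = z"
  proof (rule faithful)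
    fix x assume x: "x * e = x"
    have "z * z * x = z * (x * f)" using zx[OF x] by (simp add: mult.assoc)
    also have "\<dots> = x * f * f" by (rule zx) (simp add: mult.assoc f)
    finally show "z * z * x = z * x" using zx[OF x] by (simp add: mult.assoc f)
  qed
  \<comment> \<open>On \<open>Ae\<close>, \<open>z\<close> acts as right multiplication by
    \<open>f\<close>, which commutes with left multiplication by \<open>a\<close>.\<close>
  moreover have "z * a = a * z" for a
  proof (rule faithful)
    fix x assume x: "x * e = x"
    have "z * (a * x) = a * x * f" by (rule zx) (simp add: mult.assoc x)
    then show "z * a * x = a * z * x" using zx[OF x] by (simp add: mult.assoc)
  qed
  ultimately show thesis using that zx by blast
qed

text \<open>Multiplication by \<open>z\<close> and by \<open>1 - z\<close> splits \<open>I\<close>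
  into the two-sided ideals \<open>?J\<close> and \<open>?J'\<close>; indecomposability makes one of
  them zero.\<close>

lemma indecomposable_ideal_central_idempotent:
  assumes I: "indecomposable_ideal I" and z: "z * z = z" "\<And>a. z * a = a * z"
  shows "(\<forall>x\<in>I. x * z = 0) \<or> (\<forall>x\<in>I. x * z = x)"
proof -
  have ideal: "two_sided_ideal I" using I by (simp add: indecomposable_ideal_def)
  let ?J = "{x \<in> I. x * z = x}" and ?J' = "{x \<in> I. x * z = 0}"
  have "two_sided_ideal ?J" "two_sided_ideal ?J'"
    using ideal unfolding two_sided_ideal_def
    by (auto simp: distrib_right) (metis mult.assoc z(2) mult_zero_left mult_zero_right)+
  moreover have "?J \<inter> ?J' = {0}" using ideal by (auto simp: two_sided_ideal_def)
  moreover have "{x + y | x y. x \<in> ?J \<and> y \<in> ?J'} = I"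
  proof (intro equalityI subsetI)
    fix x assume x: "x \<in> I"
    have "x = x * z + x * (1 - z)" by (simp add: right_diff_distrib)
    moreover have "x * z \<in> ?J" "x * (1 - z) \<in> ?J'"
      using x ideal z(1) by (auto simp: two_sided_ideal_def mult.assoc left_diff_distrib)
    ultimately show "x \<in> {x + y | x y. x \<in> ?J \<and> y \<in> ?J'}" by blast
  qed (use ideal in \<open>auto simp: two_sided_ideal_def\<close>)
  ultimately have "?J = {0} \<or> ?J' = {0}" using I unfolding indecomposable_ideal_def by blast
  then show ?thesis
  proof
    assume J: "?J = {0}"
    have "x * z \<in> ?J" if "x \<in> I" for x
      using that ideal z(1) by (auto simp: two_sided_ideal_def mult.assoc)
    then show ?thesis using J by blast
  next
    assume J': "?J' = {0}"
    have "x * (1 - z) \<in> ?J'" if "x \<in> I" for x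
      using that ideal z(1) by (auto simp: two_sided_ideal_def mult.assoc left_diff_distrib)
    then have "x * (1 - z) = 0" if "x \<in> I" for x using J' that by blast
    then show ?thesis by (auto simp: right_diff_distrib)
  qed
qed

text \<open>Elements \<open>u\<close> and \<open>u'\<close> of the common block ideal fix
  \<open>x\<close> and \<open>y\<close>. If \<open>z\<close> kills the ideal, then
  \<open>x = u z x = 0\<close>; if it fixes the ideal, then \<open>y = u' z y = 0\<close>.\<close>

lemma same_block_central_idempotent:
  fixes M :: "('a::ring_1, 'm::ab_group_add, 'y) amod_scheme"
    and N :: "('a, 'n::ab_group_add, 'z) amod_scheme"
  assumes block: "same_block M N" and M: "amodule M" and N: "amodule N"
    and z: "z * z = z" "\<And>a. z * a = a * z"
    and x: "x \<in> car M" "act M z x = x" and y: "y \<in> car N" "act N z y = 0"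
  shows "x = 0 \<or> y = 0"
proof -
  obtain I u u' where I: "indecomposable_ideal I" and u: "u \<in> I" "act M u x = x"
    and u': "u' \<in> I" "act N u' y = y"
    using block x y unfolding same_block_def belongs_to_block_def block_decomposition_def by meson
  from indecomposable_ideal_central_idempotent[OF I z] show ?thesis
  proof
    assume "\<forall>x\<in>I. x * z = 0"
    then show ?thesis
      using amoduleD(6)[OF M x(1), of u z] amodule_zero_act[OF M x(1)] u x by simp
  next
    assume "\<forall>x\<in>I. x * z = x"
    then show ?thesis
      using amoduleD(6)[OF N y(1), of u' z] amoduleD(8)[OF N] u' y by simp
  qed
qed

section \<open>Top degrees of projective-injective modules within a block\<close>

theorem proposition3p22:
  fixes scale :: "'k::alg_closed_field \<Rightarrow> 'a::ring_1 \<Rightarrow> 'a"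
    and gr :: "int \<Rightarrow> 'a set"
    and star :: "'a \<Rightarrow> 'a"
    and \<Lambda> :: "'l set"
    and L :: "'l \<Rightarrow> ('a, 'm::ab_group_add) gmod"
    and P :: "'l \<Rightarrow> ('a, 'p::ab_group_add) gmod"
    and d :: "'l \<Rightarrow> nat"
    and e :: 'a
  assumes A: "positively_graded_algebra scale gr"
    and L_graded: "\<And>\<mu>. \<mu> \<in> \<Lambda> \<Longrightarrow> gmodule scale gr (L \<mu>) \<and> concentrated_in_degree_0 (L \<mu>)"
    and L_simples: "complete_simples scale \<Lambda> L"
    and P_graded: "\<And>\<mu>. \<mu> \<in> \<Lambda> \<Longrightarrow> gmodule scale gr (P \<mu>)"
    and P_cover: "\<And>\<mu>. \<mu> \<in> \<Lambda> \<Longrightarrow> \<exists>p\<in>ghom (P \<mu>) (L \<mu>). projective_cover scale (P \<mu>) (L \<mu>) p"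
    and P_degrees: "\<And>\<mu> j. \<mu> \<in> \<Lambda> \<Longrightarrow> gcomp (P \<mu>) j \<noteq> {0} \<Longrightarrow> 0 \<le> j \<and> j \<le> int (d \<mu>)"
    and P_top_degree: "\<And>\<mu>. \<mu> \<in> \<Lambda> \<Longrightarrow> gcomp (P \<mu>) (int (d \<mu>)) \<noteq> {0}"
    and nonempty: "injective_index scale \<Lambda> P \<noteq> {}"
    and star: "graded_anti_involution scale gr star"
    and L_self_dual: "\<And>\<mu>. \<mu> \<in> \<Lambda> \<Longrightarrow> gmod_iso (dual scale star (L \<mu>)) (L \<mu>)"
    and socle: "\<And>\<mu>. \<mu> \<in> injective_index scale \<Lambda> P \<Longrightarrow>
        gmod_iso (restr (P \<mu>) (soc (P \<mu>))) (shift (L \<mu>) (int (d \<mu>)))"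
    and cellular_or_highest_weight:
      "graded_cellular scale gr star \<or> graded_highest_weight scale gr star \<Lambda> L"
    and e_idempotent: "e * e = e"
    and e_degree: "e \<in> gr 0"
    and e_star: "star e = e"
    and Ae: "gmod_iso (left_ideal gr e) (direct_sum (injective_index scale \<Lambda> P) P)"
    and double_centralizer: "double_centralizer (left_ideal gr e)"
  shows "\<forall>\<mu>\<in>injective_index scale \<Lambda> P. \<forall>\<nu>\<in>injective_index scale \<Lambda> P.
           same_block (L \<mu>) (L \<nu>) \<longrightarrow> d \<mu> = d \<nu>"
proof (intro ballI impI)
  fix \<mu>\<^sub>0 \<nu>\<^sub>0
  define I where "I = injective_index scale \<Lambda> P"
  assume "\<mu>\<^sub>0 \<in> injective_index scale \<Lambda> P" "\<nu>\<^sub>0 \<in> injective_index scale \<Lambda> P"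
    and block: "same_block (L \<mu>\<^sub>0) (L \<nu>\<^sub>0)"
  then have \<mu>\<nu>: "\<mu>\<^sub>0 \<in> I" "\<nu>\<^sub>0 \<in> I" by (simp_all add: I_def)
  interpret positively_graded_algebra scale gr by (fact A)
  have I: "\<mu> \<in> \<Lambda>" if "\<mu> \<in> I" for \<mu> using that by (simp add: I_def injective_index_def)
  have L: "simple_module (L \<mu>)" "amodule (L \<mu>)" "car (L \<mu>) \<noteq> {0}" if "\<mu> \<in> I" for \<mu>
    using L_simples I[OF that] by (auto simp: complete_simples_def simple_module_def)
  have P: "amodule (P \<mu>)" "gcomp (P \<mu>) j \<subseteq> car (P \<mu>)"
    "\<And>i j a x. a \<in> gr i \<Longrightarrow> x \<in> gcomp (P \<mu>) j \<Longrightarrow> act (P \<mu>) a x \<in> gcomp (P \<mu>) (i + j)"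
    if "\<mu> \<in> I" for \<mu> j
    using P_graded[OF I[OF that]] internal_direct_sum_component[of "car (P \<mu>)" "gcomp (P \<mu>)" j]
    by (auto simp: gmodule_def)
  have "\<exists>p\<in>mhom (P \<mu>) (L \<mu>). p ` car (P \<mu>) = car (L \<mu>)" if "\<mu> \<in> I" for \<mu>
    using P_cover[OF I[OF that]] by (auto simp: projective_cover_def)
  then obtain p where p: "\<And>\<mu>. \<mu> \<in> I \<Longrightarrow> p \<mu> \<in> mhom (P \<mu>) (L \<mu>)"
    "\<And>\<mu>. \<mu> \<in> I \<Longrightarrow> p \<mu> ` car (P \<mu>) = car (L \<mu>)"
    by metis
  have P0: "car (P \<mu>) \<noteq> {0}" if "\<mu> \<in> I" for \<mu>
  proof
    assume "car (P \<mu>) = {0}"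
    then show False using p[OF that] L(3)[OF that] mhom_zero[OF p(1) P(1)] that by auto
  qed
  obtain \<epsilon> v where fin: "finite I" and e_sum: "sum \<epsilon> I = e"
    and orth: "\<And>\<mu> \<nu>. \<mu> \<in> I \<Longrightarrow> \<nu> \<in> I \<Longrightarrow> \<epsilon> \<mu> * \<epsilon> \<nu> = (if \<mu> = \<nu> then \<epsilon> \<mu> else 0)"
    and \<epsilon>: "\<And>\<mu>. \<mu> \<in> I \<Longrightarrow> \<epsilon> \<mu> \<in> gr 0" and v: "\<And>\<mu>. \<mu> \<in> I \<Longrightarrow> v \<mu> \<in> gcomp (P \<mu>) 0"
    and gen: "\<And>\<mu>. \<mu> \<in> I \<Longrightarrow> car (P \<mu>) = range (\<lambda>a. act (P \<mu>) a (v \<mu>))"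
    and ann: "\<And>\<mu> a. \<mu> \<in> I \<Longrightarrow> act (P \<mu>) a (v \<mu>) = 0 \<longleftrightarrow> a * \<epsilon> \<mu> = 0"
    by (rule left_ideal_direct_sum_idempotents
        [OF P_graded[OF I] P0 e_idempotent e_degree Ae[folded I_def]]) blast+
  have vc: "v \<mu> \<in> car (P \<mu>)" if "\<mu> \<in> I" for \<mu> using v P(2) that by blast
  have act_eq: "act (P \<mu>) a (v \<mu>) = act (P \<mu>) b (v \<mu>) \<longleftrightarrow> a * \<epsilon> \<mu> = b * \<epsilon> \<mu>" if "\<mu> \<in> I" for \<mu> a b
    using ann[OF that, of "a - b"] amodule_act_diff[OF P(1) vc] that by (simp add: left_diff_distrib)
  have \<epsilon>v: "act (P \<mu>) (\<epsilon> \<mu>) (v \<mu>) = v \<mu>" if "\<mu> \<in> I" for \<mu>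
    using act_eq[OF that, of "\<epsilon> \<mu>" 1] orth that amoduleD(7)[OF P(1) vc] by simp

  \<comment> \<open>Degrees of the corners
    \<open>\<epsilon> \<mu> A \<epsilon> \<nu>\<close>\<close>
  define N where "N \<mu> \<nu> = {k. \<exists>a\<in>gr k. \<epsilon> \<mu> * a * \<epsilon> \<nu> \<noteq> 0}" for \<mu> \<nu>
  \<comment> \<open>\<open>A \<epsilon> \<nu>\<close> is identified with \<open>P \<nu>\<close>
    through the generator \<open>v \<nu>\<close>.\<close>
  have N_act: "\<epsilon> \<mu> * a * \<epsilon> \<nu> \<noteq> 0 \<longleftrightarrow> act (P \<nu>) (\<epsilon> \<mu>) (act (P \<nu>) a (v \<nu>)) \<noteq> 0" if "\<nu> \<in> I" for \<mu> \<nu> a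
    using ann[OF that, of "\<epsilon> \<mu> * a"] amoduleD(6)[OF P(1) vc] that by simp
  have N_gcomp: "act (P \<nu>) (\<epsilon> \<mu>) (act (P \<nu>) a (v \<nu>)) \<in> gcomp (P \<nu>) k"
    if "\<mu> \<in> I" "\<nu> \<in> I" "a \<in> gr k" for \<mu> \<nu> a k
    using P(3)[OF that(2) \<epsilon>[OF that(1)] P(3)[OF that(2,3) v[OF that(2)]]] by simp
  have N_finite: "finite (N \<mu> \<nu>)" if "\<mu> \<in> I" "\<nu> \<in> I" for \<mu> \<nu>
  proof (rule finite_subset)
    show "N \<mu> \<nu> \<subseteq> {0..int (d \<nu>)}"
    proof
      fix k assume "k \<in> N \<mu> \<nu>"
      then have "gcomp (P \<nu>) k \<noteq> {0}"
        using N_act[OF that(2)] N_gcomp[OF that] by (fastforce simp: N_def)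
      then show "k \<in> {0..int (d \<nu>)}" using P_degrees[OF I[OF that(2)]] by simp
    qed
  qed simp
  have N_dual: "int (d \<nu>) - k \<in> N \<nu> \<mu>" if \<mu>: "\<mu> \<in> I" and \<nu>: "\<nu> \<in> I" and k: "k \<in> N \<mu> \<nu>" for \<mu> \<nu> k
  proof -
    obtain a where a: "a \<in> gr k" "act (P \<nu>) (\<epsilon> \<mu>) (act (P \<nu>) a (v \<nu>)) \<noteq> 0"
      using k N_act[OF \<nu>] by (auto simp: N_def)
    \<comment> \<open>The pairing is applied to the nonzero element
      \<open>\<epsilon> \<mu> a v \<nu>\<close> of degree \<open>k\<close>; the nonzero result
      factors through \<open>\<epsilon> \<nu> * b * \<epsilon> \<mu>\<close>.\<close>
    obtain b where b: "b \<in> gr (int (d \<nu>) - k)"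
      "act (P \<nu>) (\<epsilon> \<nu>) (act (P \<nu>) b (act (P \<nu>) (\<epsilon> \<mu>) (act (P \<nu>) a (v \<nu>)))) \<noteq> 0"
    proof (rule socle_pairing[OF A _ L(1)[OF \<nu>] P_graded[OF I[OF \<nu>]] vc[OF \<nu>] gen[OF \<nu>]
          \<epsilon>v[OF \<nu>] \<epsilon>[OF \<nu>] p(1)[OF \<nu>] p(2)[OF \<nu>] _ N_gcomp[OF \<mu> \<nu> a(1)] a(2)])
      show "concentrated_in_degree_0 (L \<nu>)" using L_graded I \<nu> by blast
      show "gmod_iso (restr (P \<nu>) (soc (P \<nu>))) (shift (L \<nu>) (int (d \<nu>)))"
        using socle \<nu> by (simp add: I_def)
    qed
    have "act (P \<nu>) (\<epsilon> \<nu> * b * \<epsilon> \<mu>) (act (P \<nu>) a (v \<nu>)) \<noteq> 0"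
      using b(2) amoduleD(3,6)[OF P(1)[OF \<nu>]] vc[OF \<nu>] by (simp add: mult.assoc)
    then have "\<epsilon> \<nu> * b * \<epsilon> \<mu> \<noteq> 0"
      using amodule_zero_act[OF P(1) amoduleD(3)[OF P(1) vc]] \<nu> by auto
    then show ?thesis using b(1) by (auto simp: N_def)
  qed
  have N_empty: "N \<mu> \<nu> = {}" if "\<mu> \<in> I" "\<nu> \<in> I" "d \<mu> \<noteq> d \<nu>" for \<mu> \<nu>
  proof (rule ccontr)
    assume "N \<mu> \<nu> \<noteq> {}"
    \<comment> \<open>Dualizing twice returns to \<open>N \<mu> \<nu>\<close>: \<open>k\<close> goes
      to \<open>d \<nu> - k\<close> and then to \<open>d \<mu> - (d \<nu> - k)\<close>.\<close>
    moreover have "k + (int (d \<mu>) - int (d \<nu>)) \<in> N \<mu> \<nu>" if "k \<in> N \<mu> \<nu>" for k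
      using N_dual[OF \<open>\<nu> \<in> I\<close> \<open>\<mu> \<in> I\<close> N_dual[OF \<open>\<mu> \<in> I\<close> \<open>\<nu> \<in> I\<close> that]] by (simp add: algebra_simps)
    ultimately have "int (d \<mu>) - int (d \<nu>) = 0"
      by (intro no_translation_of_finite_set[OF N_finite[OF that(1,2)]])
    then show False using that(3) by simp
  qed
  have corner: "\<epsilon> \<mu> * a * \<epsilon> \<nu> = 0" if "\<mu> \<in> I" "\<nu> \<in> I" "d \<mu> \<noteq> d \<nu>" for \<mu> \<nu> a
  proof -
    \<comment> \<open>\<open>N\<close> only sees homogeneous elements, so \<open>a\<close> is split
      into its components.\<close>
    obtain g where g: "\<And>i. g i \<in> gr i" "a = (\<Sum>i | g i \<noteq> 0. g i)"
      using internal_direct_sum_decompose[OF gr_direct_sum, of a] by blast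
    have "\<epsilon> \<mu> * g i * \<epsilon> \<nu> = 0" for i using N_empty[OF that] g(1) by (auto simp: N_def)
    then show ?thesis by (simp add: g(2) sum_distrib_left sum_distrib_right)
  qed

  \<comment> \<open>The central idempotent attached to the top degree of
    \<open>P \<mu>\<^sub>0\<close>\<close>
  define X where "X = {\<mu> \<in> I. d \<mu> = d \<mu>\<^sub>0}"
  have X: "X \<subseteq> I" "finite X" using fin by (auto simp: X_def)
  define f where "f = sum \<epsilon> X"
  have \<epsilon>f: "\<epsilon> \<mu> * f = (if \<mu> \<in> X then \<epsilon> \<mu> else 0)" if "\<mu> \<in> I" for \<mu>
  proof -
    have "\<epsilon> \<mu> * f = (\<Sum>\<nu>\<in>X. if \<mu> = \<nu> then \<epsilon> \<mu> else 0)"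
      unfolding f_def sum_distrib_left using orth[OF that] X by (intro sum.cong) auto
    then show ?thesis using X by simp
  qed
  have \<epsilon>e: "\<epsilon> \<mu> * e = \<epsilon> \<mu>" if "\<mu> \<in> I" for \<mu>
  proof -
    have "\<epsilon> \<mu> * e = (\<Sum>\<nu>\<in>I. if \<mu> = \<nu> then \<epsilon> \<mu> else 0)"
      unfolding e_sum[symmetric] sum_distrib_left using orth[OF that] by (intro sum.cong) auto
    then show ?thesis using fin that by simp
  qed
  have "f * f = (\<Sum>\<mu>\<in>X. \<epsilon> \<mu> * f)" by (simp add: f_def sum_distrib_right)
  also have "\<dots> = f" unfolding f_def by (intro sum.cong) (use \<epsilon>f X in \<open>auto simp: f_def\<close>)
  finally have ff: "f * f = f" .
  have fe: "f * e = f"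
    unfolding f_def sum_distrib_right using \<epsilon>e X by (intro sum.cong) auto
  \<comment> \<open>Indices in \<open>X\<close> and in \<open>I - X\<close> have different top
    degrees, so every corner between \<open>f\<close> and \<open>e - f\<close> vanishes.\<close>
  have fef: "f * b * (e - f) = 0" "(e - f) * b * f = 0" for b
  proof -
    have ef: "e - f = sum \<epsilon> (I - X)"
      using sum_diff[OF fin X(1), of \<epsilon>] e_sum by (simp add: f_def)
    show "f * b * (e - f) = 0" "(e - f) * b * f = 0"
      unfolding ef unfolding f_def sum_distrib_left sum_distrib_right
      by (intro sum.neutral ballI; use X in \<open>auto simp: X_def intro!: corner\<close>)+
  qed
  obtain z where z: "z * z = z" "\<And>a. z * a = a * z" "\<And>x. x * e = x \<Longrightarrow> z * x = x * f"
  proof (rule double_centralizer_central_idempotent[OF double_centralizer e_idempotent ff fe])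
    \<comment> \<open>For \<open>b\<close> in \<open>eAe\<close>, the vanishing corners make both
      products equal to \<open>f * b * f\<close>.\<close>
    show "b * f = f * b" if b: "e * b = b" "b * e = b" for b
    proof -
      have "b * f = f * b * f"
        using fef(2)[of b] b(1) by (simp add: left_diff_distrib)
      also have "\<dots> = f * b * e"
        using fef(1)[of b] by (simp add: right_diff_distrib)
      also have "\<dots> = f * b"
        by (simp add: mult.assoc b(2))
      finally show ?thesis .
    qed
  qed blast
  \<comment> \<open>\<open>\<epsilon> \<mu>\<close> lies in \<open>Ae\<close>, so
    \<open>z * \<epsilon> \<mu> = \<epsilon> \<mu> * f\<close>; this carries over to
    \<open>P \<mu>\<close> through its generator.\<close>
  have zv: "act (P \<mu>) z (v \<mu>) = (if \<mu> \<in> X then v \<mu> else 0)" if "\<mu> \<in> I" for \<mu>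
  proof (cases "\<mu> \<in> X")
    case True
    then show ?thesis
      using act_eq[OF that, of z 1] z(3)[OF \<epsilon>e[OF that]] \<epsilon>f[OF that] amoduleD(7)[OF P(1) vc] that by simp
  next
    case False
    then show ?thesis using ann[OF that, of z] z(3)[OF \<epsilon>e[OF that]] \<epsilon>f[OF that] by simp
  qed
  \<comment> \<open>The image of the generator is a nonzero vector of \<open>L \<mu>\<close> on
    which \<open>z\<close> acts as 1 or 0, which reveals whether \<open>\<mu>\<close> lies in
    \<open>X\<close>.\<close>
  have pv: "p \<mu> (v \<mu>) \<in> car (L \<mu>)" "p \<mu> (v \<mu>) \<noteq> 0"
    "act (L \<mu>) z (p \<mu> (v \<mu>)) = (if \<mu> \<in> X then p \<mu> (v \<mu>) else 0)" if "\<mu> \<in> I" for \<mu>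
  proof -
    note hom = mhomD[OF p(1)[OF that]]
    show "p \<mu> (v \<mu>) \<in> car (L \<mu>)" using hom(1) vc that by blast
    show "act (L \<mu>) z (p \<mu> (v \<mu>)) = (if \<mu> \<in> X then p \<mu> (v \<mu>) else 0)"
      using hom(3)[OF vc[OF that], of z] zv[OF that] mhom_zero[OF p(1) P(1)] that by auto
    show "p \<mu> (v \<mu>) \<noteq> 0"
    proof
      assume "p \<mu> (v \<mu>) = 0"
      then have "p \<mu> x = 0" if "x \<in> car (P \<mu>)" for x
        using that gen[OF \<open>\<mu> \<in> I\<close>] hom(3)[OF vc[OF \<open>\<mu> \<in> I\<close>]] amoduleD(8)[OF L(2)[OF \<open>\<mu> \<in> I\<close>]] by auto
      then have "car (L \<mu>) \<subseteq> {0}" using p(2)[OF that] by auto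
      then show False using L(3)[OF that] amoduleD(1)[OF L(2)[OF that]] by auto
    qed
  qed
  show "d \<mu>\<^sub>0 = d \<nu>\<^sub>0"
  proof (rule ccontr)
    assume "d \<mu>\<^sub>0 \<noteq> d \<nu>\<^sub>0"
    then have "\<mu>\<^sub>0 \<in> X" "\<nu>\<^sub>0 \<notin> X" using \<mu>\<nu> by (auto simp: X_def)
    \<comment> \<open>Within one block \<open>z\<close> cannot fix a nonzero vector of
      \<open>L \<mu>\<^sub>0\<close> and kill one of \<open>L \<nu>\<^sub>0\<close>.\<close>
    then show False
      using same_block_central_idempotent[OF block L(2)[OF \<mu>\<nu>(1)] L(2)[OF \<mu>\<nu>(2)] z(1,2)
          pv(1)[OF \<mu>\<nu>(1)] _ pv(1)[OF \<mu>\<nu>(2)]] pv(2,3)[OF \<mu>\<nu>(1)] pv(2,3)[OF \<mu>\<nu>(2)] by simp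
  qed
qed

end
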